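(* Let $V$ be an $n$-dimensional $F$-vector space, let $T:V\to V$ be a linear transformation (not necessarily invertible), and let $\Lambda$ be a lattice in $V$. Put $\mu=\mu(T,\Lambda)=(\mu_1,\dots,\mu_n)$ (the Hodge point) and $\nu=\nu(T)=(\nu_1,\dots,\nu_n)$ (the Newton point). Then the following two conclusions hold. (1) $\nu(T)\le\mu(T,\Lambda)$. (2) Suppose that $V$ is the direct sum of linear subspaces $U,W$ having the property that $TU\subset U$ and $TW\subset W$. Suppose further that every slope of $T$ on $U$ is strictly less than every slope of $T$ on $W$. Finally, put $r=\dim U$ and suppose that $\mu_1+\dots+\mu_r=\nu_1+\dots+\nu_r$. Then $\Lambda$ decomposes as $$\Lambda=(\Lambda\cap U)\oplus(\Lambda\cap W).$$
   Context: $\mathfrak o$ is a complete discrete valuation ring with fraction field $F$ and uniformizer $\varpi$; $\overline F$ is an algebraic closure of $F$; $\mathrm{val}:\overline F^\times\to\mathbb Q$ is the valuation with $\mathrm{val}(\varpi)=1$, extended by $\mathrm{val}(0)=\infty$. Put $\tilde{\mathbb Q}=\mathbb Q\cup\{\infty\}$, totally ordered with $\infty$ as greatest element, with $x+\infty=\infty+x=\infty$ for all $x$; also $\varpi^\infty:=0$. Newton point: if $T$ is an endomorphism of an $n$-dimensional $F$-vector space with eigenvalues $\lambda_1,\dots,\lambda_n\in\overline F$ (with multiplicity), its slopes are the $\nu_i=\mathrm{val}(\lambda_i)\in\tilde{\mathbb Q}$; numbering them so that $\nu_1\le\dots\le\nu_n$, the Newton point is $\nu(T)=(\nu_1,\dots,\nu_n)$.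 Hodge point: a lattice $\Lambda$ in $V$ is an $\mathfrak o$-submodule, free of rank $n=\dim V$, spanning $V$. There exist an $\mathfrak o$-basis $e_1,\dots,e_n$ of $\Lambda$ and elements $\mu_1\le\dots\le\mu_n$ of $\mathbb Z\cup\{\infty\}$ with $T\Lambda=\mathfrak o\varpi^{\mu_1}e_1+\dots+\mathfrak o\varpi^{\mu_n}e_n$; the Hodge point $\mu(T,\Lambda)=(\mu_1,\dots,\mu_n)$ is independent of choices. Dominance order: for non-decreasing $n$-tuples $\mu,\nu$ in $\tilde{\mathbb Q}^n$, $\nu\le\mu$ means $\mu_1+\dots+\mu_i\le\nu_1+\dots+\nu_i$ for $i=1,\dots,n-1$ and $\mu_1+\dots+\mu_n=\nu_1+\dots+\nu_n$. *)

theory Defs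
  imports
    "HOL-Library.Extended"
    "HOL-Algebra.Algebraic_Closure_Type"
    "Jordan_Normal_Form.Char_Poly"
begin

section \<open>Valuations and complete discrete valuation rings\<close>

text \<open>
  The type \<open>'g extended\<close> is \<open>'g\<close> together with \<open>Pinf\<close> and \<open>Minf\<close>.  Only \<open>Pinf\<close> plays a role here:
  \<open>rat extended\<close> without \<open>Minf\<close> is $\mathbb Q\cup\{\infty\}$ and \<open>int extended\<close> without \<open>Minf\<close> is
  $\mathbb Z\cup\{\infty\}$, so the value \<open>Minf\<close> has to be excluded explicitly.
\<close>

definition valuation :: "('k::field \<Rightarrow> 'g::linordered_ab_group_add extended) \<Rightarrow> bool" where
  "valuation v \<longleftrightarrow>
     (\<forall>x. v x \<noteq> Minf) \<and>
     (\<forall>x. v x = Pinf \<longleftrightarrow> x = 0) \<and>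
     (\<forall>x y. v (x * y) = v x + v y) \<and>
     (\<forall>x y. min (v x) (v y) \<le> v (x + y))"

text \<open>
  A discrete valuation ring with fraction field \<open>'k\<close> is the valuation ring of a discrete valuation of
  \<open>'k\<close>, i.e. of a valuation with value group $\mathbb Z$.
\<close>

definition discrete_valuation :: "('k::field \<Rightarrow> int extended) \<Rightarrow> bool" where
  "discrete_valuation v \<longleftrightarrow> valuation v \<and> v ` (- {0}) = range Fin"

definition is_dvr :: "'k::field set \<Rightarrow> bool" where
  "is_dvr \<oo> \<longleftrightarrow> (\<exists>v. discrete_valuation v \<and> \<oo> = {x. 0 \<le> v x})"

text \<open>A uniformizer generates the maximal ideal, which consists of the non-units.\<close>

definition is_uniformizer :: "'k::field set \<Rightarrow> 'k \<Rightarrow> bool" where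
  "is_uniformizer \<oo> \<pi> \<longleftrightarrow> \<pi> \<in> \<oo> \<and> {x \<in> \<oo>. \<not> (\<exists>y\<in>\<oo>. x * y = 1)} = (\<lambda>x. \<pi> * x) ` \<oo>"

definition adically_complete :: "'k::field set \<Rightarrow> 'k \<Rightarrow> bool" where
  "adically_complete \<oo> \<pi> \<longleftrightarrow>
     (\<forall>a :: nat \<Rightarrow> 'k.
        range a \<subseteq> \<oo> \<and>
        (\<forall>k. \<exists>N. \<forall>m\<ge>N. \<forall>n\<ge>N. a m - a n \<in> (\<lambda>x. \<pi> ^ k * x) ` \<oo>) \<longrightarrow>
        (\<exists>l\<in>\<oo>. \<forall>k. \<exists>N. \<forall>n\<ge>N. a n - l \<in> (\<lambda>x. \<pi> ^ k * x) ` \<oo>))"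

definition is_complete_dvr :: "'k::field set \<Rightarrow> 'k \<Rightarrow> bool" where
  "is_complete_dvr \<oo> \<pi> \<longleftrightarrow> is_dvr \<oo> \<and> is_uniformizer \<oo> \<pi> \<and> adically_complete \<oo> \<pi>"

text \<open>
  The valuation of the algebraic closure that extends the valuation of the fraction field and is
  normalized by the uniformizer; for a complete \<open>\<oo>\<close> there is exactly one.
\<close>

definition is_extended_valuation ::
    "'k::field set \<Rightarrow> 'k \<Rightarrow> ('k alg_closure \<Rightarrow> rat extended) \<Rightarrow> bool" where
  "is_extended_valuation \<oo> \<pi> val \<longleftrightarrow>
     valuation val \<and> \<oo> = {x. 0 \<le> val (to_ac x)} \<and> val (to_ac \<pi>) = 1"

text \<open>Integral powers of \<open>\<pi>\<close>, with $\pi^\infty = 0$; the value at \<open>Minf\<close> is irrelevant.\<close>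

definition extended_power :: "'k::field \<Rightarrow> int extended \<Rightarrow> 'k" where
  "extended_power \<pi> m = (case m of Fin k \<Rightarrow> \<pi> powi k | Pinf \<Rightarrow> 0 | Minf \<Rightarrow> 0)"


section \<open>The dominance order\<close>

text \<open>
  \<open>dominated \<nu> \<mu>\<close> is the relation $\nu\le\mu$ for non-decreasing tuples; note that the partial sums of
  the larger tuple \<open>\<mu>\<close> are the smaller ones.
\<close>

definition dominated :: "rat extended list \<Rightarrow> rat extended list \<Rightarrow> bool" where
  "dominated \<nu> \<mu> \<longleftrightarrow>
     length \<nu> = length \<mu> \<and>
     (\<forall>i. 1 \<le> i \<and> i < length \<mu> \<longrightarrow> sum_list (take i \<mu>) \<le> sum_list (take i \<nu>)) \<and>
     sum_list \<mu> = sum_list \<nu>"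


section \<open>Newton points and Hodge points\<close>

definition is_direct_sum :: "'v::ab_group_add set \<Rightarrow> 'v set \<Rightarrow> 'v set \<Rightarrow> bool" where
  "is_direct_sum A B C \<longleftrightarrow> A = {b + c | b c. b \<in> B \<and> c \<in> C} \<and> B \<inter> C = {0}"

text \<open>In what follows, \<open>scale\<close> is the scalar multiplication of a vector space with carrier \<open>UNIV\<close>.\<close>

definition ordered_basis ::
    "('k::field \<Rightarrow> 'v::ab_group_add \<Rightarrow> 'v) \<Rightarrow> 'v set \<Rightarrow> 'v list \<Rightarrow> bool" where
  "ordered_basis scale S bs \<longleftrightarrow>
     distinct bs \<and> \<not> module.dependent scale (set bs) \<and> module.span scale (set bs) = S"

definition matrix_wrt ::
    "('k::field \<Rightarrow> 'v::ab_group_add \<Rightarrow> 'v) \<Rightarrow> 'v list \<Rightarrow> ('v \<Rightarrow> 'v) \<Rightarrow> 'k mat" where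
  "matrix_wrt scale bs T =
     mat (length bs) (length bs)
       (\<lambda>(i, j). module.representation scale (set bs) (T (bs ! j)) (bs ! i))"

text \<open>
  For a finite-dimensional \<open>T\<close>-invariant subspace \<open>S\<close>, this is the characteristic polynomial of the
  restriction of \<open>T\<close> to \<open>S\<close>; it does not depend on the chosen basis.
\<close>

definition char_poly_on ::
    "('k::field \<Rightarrow> 'v::ab_group_add \<Rightarrow> 'v) \<Rightarrow> ('v \<Rightarrow> 'v) \<Rightarrow> 'v set \<Rightarrow> 'k poly" where
  "char_poly_on scale T S = char_poly (matrix_wrt scale (SOME bs. ordered_basis scale S bs) T)"

definition eigenvalues_on ::
    "('k::field \<Rightarrow> 'v::ab_group_add \<Rightarrow> 'v) \<Rightarrow> ('v \<Rightarrow> 'v) \<Rightarrow> 'v set \<Rightarrow> 'k alg_closure multiset" where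
  "eigenvalues_on scale T S = proots (map_poly to_ac (char_poly_on scale T S))"

definition slopes_on ::
    "('k::field \<Rightarrow> 'v::ab_group_add \<Rightarrow> 'v) \<Rightarrow> ('k alg_closure \<Rightarrow> rat extended) \<Rightarrow>
     ('v \<Rightarrow> 'v) \<Rightarrow> 'v set \<Rightarrow> rat extended multiset" where
  "slopes_on scale val T S = image_mset val (eigenvalues_on scale T S)"

definition newton_point ::
    "('k::field \<Rightarrow> 'v::ab_group_add \<Rightarrow> 'v) \<Rightarrow> ('k alg_closure \<Rightarrow> rat extended) \<Rightarrow>
     ('v \<Rightarrow> 'v) \<Rightarrow> rat extended list" where
  "newton_point scale val T = sorted_list_of_multiset (slopes_on scale val T UNIV)"

definition lin_comb ::
    "('k::field \<Rightarrow> 'v::ab_group_add \<Rightarrow> 'v) \<Rightarrow> (nat \<Rightarrow> 'k) \<Rightarrow> 'v list \<Rightarrow> 'v" where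
  "lin_comb scale c xs = (\<Sum>i<length xs. scale (c i) (xs ! i))"

definition span_over ::
    "('k::field \<Rightarrow> 'v::ab_group_add \<Rightarrow> 'v) \<Rightarrow> 'k set \<Rightarrow> 'v list \<Rightarrow> 'v set" where
  "span_over scale \<oo> xs = {lin_comb scale c xs | c. \<forall>i<length xs. c i \<in> \<oo>}"

definition basis_over ::
    "('k::field \<Rightarrow> 'v::ab_group_add \<Rightarrow> 'v) \<Rightarrow> 'k set \<Rightarrow> 'v list \<Rightarrow> 'v set \<Rightarrow> bool" where
  "basis_over scale \<oo> es \<Lambda> \<longleftrightarrow>
     \<Lambda> = span_over scale \<oo> es \<and>
     (\<forall>c. (\<forall>i<length es. c i \<in> \<oo>) \<and> lin_comb scale c es = 0 \<longrightarrow> (\<forall>i<length es. c i = 0))"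

definition is_lattice ::
    "('k::field \<Rightarrow> 'v::ab_group_add \<Rightarrow> 'v) \<Rightarrow> 'k set \<Rightarrow> 'v set \<Rightarrow> bool" where
  "is_lattice scale \<oo> \<Lambda> \<longleftrightarrow>
     (\<exists>es. length es = vector_space.dim scale (UNIV :: 'v set) \<and> basis_over scale \<oo> es \<Lambda>) \<and>
     module.span scale \<Lambda> = UNIV"

definition is_hodge_tuple ::
    "('k::field \<Rightarrow> 'v::ab_group_add \<Rightarrow> 'v) \<Rightarrow> 'k set \<Rightarrow> 'k \<Rightarrow> ('v \<Rightarrow> 'v) \<Rightarrow> 'v set \<Rightarrow>
     int extended list \<Rightarrow> bool" where
  "is_hodge_tuple scale \<oo> \<pi> T \<Lambda> ms \<longleftrightarrow>
     Minf \<notin> set ms \<and> sorted ms \<and>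
     (\<exists>es. length es = vector_space.dim scale (UNIV :: 'v set) \<and> length ms = length es \<and>
        basis_over scale \<oo> es \<Lambda> \<and>
        T ` \<Lambda> = span_over scale \<oo> (map2 (\<lambda>m e. scale (extended_power \<pi> m) e) ms es))"

text \<open>The Hodge point, viewed in $(\mathbb Q\cup\{\infty\})^n$.\<close>

definition hodge_point ::
    "('k::field \<Rightarrow> 'v::ab_group_add \<Rightarrow> 'v) \<Rightarrow> 'k set \<Rightarrow> 'k \<Rightarrow> ('v \<Rightarrow> 'v) \<Rightarrow> 'v set \<Rightarrow>
     rat extended list" where
  "hodge_point scale \<oo> \<pi> T \<Lambda> =
     map (map_extended of_int) (THE ms. is_hodge_tuple scale \<oo> \<pi> T \<Lambda> ms)"

end

theory Submission
  imports Defs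
begin

text \<open>
  Both points are read off from one matrix: the matrix \<open>A\<close> of \<open>T\<close> in a basis of \<open>\<Lambda>\<close>.  The link between
  them is the least valuation of an \<open>i \<times> i\<close> minor of \<open>A\<close>, which does not change when \<open>A\<close> is multiplied
  on either side by an integral matrix with integral inverse, even one over the algebraic closure.

  These least valuations are the partial sums of the Hodge point.  The definition of
  \<open>\<mu>(T, \<Lambda>)\<close> says that \<open>A\<close> and \<open>D = diag(\<pi>\<^sup>\<mu>)\<close> are obtained from each other by integral multiplications
  on both sides, so \<open>\<mu>\<^sub>1 + \<dots> + \<mu>\<^sub>i\<close> is the least valuation of an \<open>i\<close>-minor of \<open>A\<close> (\<open>hodge_minors\<close>).  This
  shows that \<open>\<mu>\<close> is unique; it exists by the Smith normal form (\<open>Smith_decomposition\<close>).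

  For the inequality, \<open>A\<close> is made upper triangular over the algebraic closure by a
  change of basis that is invertible over its valuation ring, with the eigenvalues on the diagonal in
  order of increasing valuation (\<open>integral_triangularization\<close>).  The leading \<open>i\<close>-minor of the triangular
  matrix is the product of the first \<open>i\<close> eigenvalues, of valuation \<open>\<nu>\<^sub>1 + \<dots> + \<nu>\<^sub>i\<close>; this is at least the
  minimum \<open>\<mu>\<^sub>1 + \<dots> + \<mu>\<^sub>i\<close>.  For \<open>i = n\<close> there is only the determinant, and equality holds.

  For the decomposition, let \<open>E\<close> be the matrix of the projection onto \<open>U\<close> along \<open>W\<close>; \<open>\<Lambda>\<close> is the
  sum of its intersections with \<open>U\<close> and \<open>W\<close> as soon as \<open>E\<close> is integral.  Triangularize \<open>T\<close> on \<open>U\<close> and on \<open>W\<close> over the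
  algebraic closure and apply the Iwasawa decomposition (\<open>Iwasawa_decomposition\<close>) to the resulting
  basis of the whole space.  In the new coordinates, integrally equivalent to the old ones, \<open>T\<close> is upper
  triangular with diagonal \<open>\<lambda>\<^sub>1, \<dots>, \<lambda>\<^sub>n\<close>, the first \<open>r\<close> of them belonging to \<open>U\<close>, and \<open>E\<close> is a block
  matrix with rows \<open>(1, Z)\<close> and \<open>(0, 0)\<close>.  The entries of \<open>Z\<close> are integral by induction, starting from
  its lower left corner (\<open>triangular_projection_integral\<close>).  To treat \<open>z = Z\<^sub>i\<^sub>j\<close>, conjugate by an integral
  unipotent matrix that replaces by 0 the other entries of \<open>Z\<close> in the rectangle between \<open>z\<close> and that
  corner, which are already known to be integral.  Since \<open>E\<close> commutes with \<open>T\<close>, the \<open>r\<close>-minor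
  in which column \<open>i\<close> of the leading block is replaced by column \<open>j\<close> is then triangular, with
  \<open>z (\<lambda>\<^sub>i - \<lambda>\<^sub>j)\<close> in the place of \<open>\<lambda>\<^sub>i\<close>.  As \<open>\<lambda>\<^sub>i\<close> has smaller valuation than \<open>\<lambda>\<^sub>j\<close>, this minor has valuation
  \<open>\<nu>\<^sub>1 + \<dots> + \<nu>\<^sub>r + val z\<close>.  By hypothesis the least valuation of an \<open>r\<close>-minor is
  \<open>\<mu>\<^sub>1 + \<dots> + \<mu>\<^sub>r = \<nu>\<^sub>1 + \<dots> + \<nu>\<^sub>r\<close>, so \<open>z\<close> is integral.
\<close>

no_notation fps_nth (infixl "$" 75)

section \<open>Matrices, determinants and sums\<close>

instance extended :: (ordered_comm_monoid_add) ordered_comm_monoid_add ..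

lemma mat_mult_entry:
  assumes "A \<in> carrier_mat a n" "B \<in> carrier_mat n b" "i < a" "j < b"
  shows "(A * B) $$ (i, j) = (\<Sum>k<n. A $$ (i, k) * B $$ (k, j))"
  using assms by (auto simp: scalar_prod_def atLeast0LessThan intro!: sum.cong)

lemma upper_triangular_mult:
  fixes A B :: "'a::semiring_0 mat"
  assumes A: "A \<in> carrier_mat n n" "upper_triangular A" and B: "B \<in> carrier_mat n n" "upper_triangular B"
  shows "upper_triangular (A * B)" and "i < n \<Longrightarrow> (A * B) $$ (i, i) = A $$ (i, i) * B $$ (i, i)"
proof -
  have nz: "A $$ (i, k) * B $$ (k, j) = 0" if "i < n" "k < n" "j \<le> i" "k \<noteq> i \<or> j < i" for i j k
  proof (cases "k < i")
    case True then show ?thesis using that A by (simp add: upper_triangularD)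
  next
    case False
    then have "j < k" using that by auto
    then show ?thesis using that B by (simp add: upper_triangularD)
  qed
  show "upper_triangular (A * B)"
    using A B nz by (intro upper_triangularI) (auto simp: mat_mult_entry[OF A(1) B(1)] simp del: index_mult_mat(1) intro!: sum.neutral)
  show "(A * B) $$ (i, i) = A $$ (i, i) * B $$ (i, i)" if "i < n"
  proof -
    have "(\<Sum>k<n. A $$ (i, k) * B $$ (k, i)) = (\<Sum>k<n. if k = i then A $$ (i, i) * B $$ (i, i) else 0)"
      using nz that by (intro sum.cong) auto
    then show ?thesis using that by (simp add: mat_mult_entry[OF A(1) B(1)] del: index_mult_mat(1))
  qed
qed

lemma upper_triangular_inverse:
  fixes H :: "'a::idom mat"
  assumes H: "H \<in> carrier_mat n n" "upper_triangular H" and Hi: "Hi \<in> carrier_mat n n"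
    and inv: "Hi * H = 1\<^sub>m n"
  shows "upper_triangular Hi"
proof -
  have "det Hi * det H = 1"
    using det_mult[OF Hi H(1)] inv by simp
  then have "det H \<noteq> 0" by auto
  then have diag: "H $$ (j, j) \<noteq> 0" if "j < n" for j
    using that H by (auto simp: det_upper_triangular[OF H(2,1)] diag_mat_def prod_list_zero_iff)
  have "Hi $$ (k, j) = 0" if "k < n" "j < k" for j k
    using that
  proof (induction j arbitrary: k rule: less_induct)
    case (less j)
    have "0 = (Hi * H) $$ (k, j)" using less inv by simp
    also have "\<dots> = (\<Sum>l<n. Hi $$ (k, l) * H $$ (l, j))"
      using less by (intro mat_mult_entry[OF Hi H(1)]) auto
    also have "\<dots> = (\<Sum>l<n. if l = j then Hi $$ (k, j) * H $$ (j, j) else 0)"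
    proof (intro sum.cong refl)
      fix l assume l: "l \<in> {..<n}"
      consider "l < j" | "l = j" | "j < l" by linarith
      then show "Hi $$ (k, l) * H $$ (l, j) = (if l = j then Hi $$ (k, j) * H $$ (j, j) else 0)"
        using less l H by cases (auto simp: upper_triangularD)
    qed
    finally show ?case using diag[of j] less by simp
  qed
  then show ?thesis using Hi by (intro upper_triangularI) auto
qed

text \<open>
  Removing the largest element \<open>s\<close> of \<open>S\<close> gives the induction: since \<open>S \<subseteq> {..s}\<close>, the index \<open>s\<close> is at
  least \<open>card S - 1\<close>, so the last term of the left-hand sum is at most \<open>f s\<close>.
\<close>
lemma sum_first_le_sum_subset:
  fixes f :: "nat \<Rightarrow> 'g::{ordered_comm_monoid_add,linorder}"
  assumes mono: "\<And>i j. i \<le> j \<Longrightarrow> j < n \<Longrightarrow> f i \<le> f j"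
    and "S \<subseteq> {..<n}"
  shows "(\<Sum>k<card S. f k) \<le> (\<Sum>s\<in>S. f s)"
proof -
  have "finite S" using assms(2) finite_subset by blast
  then show ?thesis using assms(2)
  proof (induction "card S" arbitrary: S)
    case 0 then show ?case by simp
  next
    case (Suc m)
    define s where "s = Max S"
    have ne: "S \<noteq> {}" using Suc by auto
    have s: "s \<in> S" using Suc ne by (simp add: s_def)
    have "S \<subseteq> {..s}" using Suc by (auto simp: s_def)
    then have "card S \<le> Suc s" using card_mono[of "{..s}" S] by simp
    then have "m \<le> s" using Suc by simp
    then have le: "f m \<le> f s" using s Suc mono by auto
    have "m = card (S - {s})" using Suc s by simp
    then have "(\<Sum>k<m. f k) \<le> (\<Sum>s\<in>S-{s}. f s)" using Suc(1)[of "S - {s}"] Suc by auto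
    with le have "(\<Sum>k<m. f k) + f m \<le> (\<Sum>s\<in>S-{s}. f s) + f s" by (rule add_mono[rotated])
    also have "\<dots> = (\<Sum>s\<in>S. f s)" using s Suc by (subst sum.remove[of S s]) (auto simp: add.commute)
    finally show ?case using Suc(2) by (metis sum.lessThan_Suc)
  qed
qed

text \<open>
  Multilinearity in the rows: row \<open>k\<close> of \<open>A * B\<close> is a combination of rows of \<open>B\<close>, and \<open>g\<close> chooses a row
  for each \<open>k\<close>.  The terms with \<open>g\<close> not injective vanish, because a row is repeated; grouping the other
  terms by the image of \<open>g\<close> would give the Cauchy--Binet formula.
\<close>
lemma det_mult_rectangular:
  fixes A B :: "'a::comm_ring_1 mat"
  assumes A: "A \<in> carrier_mat i n" and B: "B \<in> carrier_mat n i"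
  shows "det (A * B) = (\<Sum>g\<in>{0..<i} \<rightarrow>\<^sub>E {..<n}. (\<Prod>k = 0..<i. A $$ (k, g k)) * det (mat i i (\<lambda>(k, l). B $$ (g k, l))))"
proof -
  let ?S = "{p. p permutes {0..<i}}" and ?G = "{0..<i} \<rightarrow>\<^sub>E {..<n}"
  have "det (A * B) = (\<Sum>p\<in>?S. signof p * (\<Prod>k = 0..<i. (A * B) $$ (k, p k)))"
    using A B by (intro det_def') auto
  also have "\<dots> = (\<Sum>p\<in>?S. signof p * (\<Prod>k = 0..<i. \<Sum>m<n. A $$ (k, m) * B $$ (m, p k)))"
    by (intro sum.cong refl arg_cong2[where f = "(*)"] prod.cong)
       (auto simp: mat_mult_entry[OF A B] permutes_in_image simp del: index_mult_mat(1))
  also have "\<dots> = (\<Sum>p\<in>?S. signof p * (\<Sum>g\<in>?G. \<Prod>k = 0..<i. A $$ (k, g k) * B $$ (g k, p k)))"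
    by (subst prod_sum_PiE) auto
  also have "\<dots> = (\<Sum>g\<in>?G. \<Sum>p\<in>?S. signof p * (\<Prod>k = 0..<i. A $$ (k, g k) * B $$ (g k, p k)))"
    unfolding sum_distrib_left by (rule sum.swap)
  also have "\<dots> = (\<Sum>g\<in>?G. (\<Prod>k = 0..<i. A $$ (k, g k)) * (\<Sum>p\<in>?S. signof p * (\<Prod>k = 0..<i. B $$ (g k, p k))))"
    by (simp add: prod.distrib sum_distrib_left mult_ac)
  also have "\<dots> = (\<Sum>g\<in>?G. (\<Prod>k = 0..<i. A $$ (k, g k)) * det (mat i i (\<lambda>(k, l). B $$ (g k, l))))"
  proof (intro sum.cong refl arg_cong2[where f = "(*)"])
    fix g assume "g \<in> ?G"
    show "(\<Sum>p\<in>?S. signof p * (\<Prod>k = 0..<i. B $$ (g k, p k))) = det (mat i i (\<lambda>(k, l). B $$ (g k, l)))"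
      by (subst det_def'[of _ i]) (auto intro!: sum.cong prod.cong arg_cong2[where f = "(*)"] simp: permutes_in_image)
  qed
  finally show ?thesis .
qed

section \<open>Valued fields and integral matrices\<close>

locale valued_field =
  fixes v :: "'k::field \<Rightarrow> 'g::linordered_ab_group_add extended"
  assumes valuation: "valuation v"
begin

lemma v_not_Minf [simp]: "v x \<noteq> Minf"
  and v_eq_Pinf_iff [simp]: "v x = Pinf \<longleftrightarrow> x = 0"
  and v_mult: "v (x * y) = v x + v y"
  and v_add_ge_min: "min (v x) (v y) \<le> v (x + y)"
  using valuation by (auto simp: valuation_def)

lemma v_0 [simp]: "v 0 = Pinf" by simp

lemma v_Fin: "x \<noteq> 0 \<Longrightarrow> \<exists>g. v x = Fin g"
  by (cases "v x") auto

lemma v_1 [simp]: "v 1 = 0"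
proof -
  obtain g where g: "v 1 = Fin g" using v_Fin[of 1] by auto
  then show ?thesis using v_mult[of 1 1] by (simp add: zero_extended_def)
qed

lemma v_uminus [simp]: "v (- x) = v x"
proof -
  obtain g where g: "v (-1) = Fin g" using v_Fin[of "-1"] by auto
  have "g + g = 0" using v_mult[of "-1" "-1"] g by (simp add: zero_extended_def)
  then have "v (-1) = 0" using g by (simp add: zero_extended_def)
  then show ?thesis using v_mult[of "-1" x] by simp
qed

lemma v_add_ge: "c \<le> v x \<Longrightarrow> c \<le> v y \<Longrightarrow> c \<le> v (x + y)"
  using v_add_ge_min[of x y] by (meson min.boundedI order_trans)

lemma v_sum_ge: "(\<And>x. x \<in> A \<Longrightarrow> c \<le> v (f x)) \<Longrightarrow> c \<le> v (sum f A)"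
  by (induction A rule: infinite_finite_induct) (auto intro: v_add_ge)

lemma v_prod: "v (prod f A) = (\<Sum>x\<in>A. v (f x))"
  by (induction A rule: infinite_finite_induct) (auto simp: v_mult)

lemma v_prod_list: "v (prod_list xs) = sum_list (map v xs)"
  by (induction xs) (auto simp: v_mult)

lemma v_mult_nonneg: "0 \<le> v x \<Longrightarrow> 0 \<le> v y \<Longrightarrow> 0 \<le> v (x * y)"
  by (simp add: v_mult)

lemma v_divide_nonneg:
  assumes "y \<noteq> 0" "v y \<le> v x"
  shows "0 \<le> v (x / y)"
proof (cases "x = 0")
  case False
  have "v x = v (x / y) + v y" using assms v_mult[of "x / y" y] by simp
  moreover obtain a b c where "v x = Fin a" "v y = Fin b" "v (x / y) = Fin c"
    using v_Fin[of x] v_Fin[of y] v_Fin[of "x / y"] False assms by auto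
  ultimately show ?thesis using assms by (auto simp: zero_extended_def)
qed auto

lemma v_inverse_nonneg: "v x = 0 \<Longrightarrow> v (inverse x) = 0"
proof -
  assume x: "v x = 0"
  then have "x \<noteq> 0" by (auto simp: zero_extended_def)
  then have "v x + v (inverse x) = 0" using v_mult[of x "inverse x"] by simp
  then show ?thesis using x by simp
qed

lemma v_diff_eq:
  assumes "v x < v y"
  shows "v (x - y) = v x"
proof (rule antisym)
  have "v (x - y) \<ge> v x" using v_add_ge[of "v x" x "- y"] assms by simp
  moreover have "min (v (x - y)) (v y) \<le> v x" using v_add_ge_min[of "x - y" y] by simp
  ultimately show "v (x - y) \<le> v x" "v x \<le> v (x - y)" using assms by (auto simp: min_def split: if_splits)
qed

definition integral_mat :: "'k mat \<Rightarrow> bool" where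
  "integral_mat M \<longleftrightarrow> (\<forall>i<dim_row M. \<forall>j<dim_col M. 0 \<le> v (M $$ (i, j)))"

lemma v_mat_mult_ge:
  assumes A: "A \<in> carrier_mat a n" and B: "B \<in> carrier_mat n b" and ij: "i < a" "j < b"
    and c: "\<And>k. k < n \<Longrightarrow> c \<le> v (A $$ (i, k)) + v (B $$ (k, j))"
  shows "c \<le> v ((A * B) $$ (i, j))"
  using c by (auto simp: mat_mult_entry[OF A B ij] v_mult simp del: index_mult_mat(1) intro!: v_sum_ge)

lemma integral_matD: "integral_mat M \<Longrightarrow> M \<in> carrier_mat a b \<Longrightarrow> i < a \<Longrightarrow> j < b \<Longrightarrow> 0 \<le> v (M $$ (i, j))"
  by (auto simp: integral_mat_def)

lemma integral_mat_mult:
  assumes "A \<in> carrier_mat a n" "B \<in> carrier_mat n b" "integral_mat A" "integral_mat B"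
  shows "integral_mat (A * B)"
  using assms unfolding integral_mat_def
  by (auto intro!: v_mat_mult_ge[OF assms(1,2)] add_nonneg_nonneg simp del: index_mult_mat(1))

lemma integral_mat_one [simp]: "integral_mat (1\<^sub>m n)"
  by (auto simp: integral_mat_def)

lemma integral_mat_zero [simp]: "integral_mat (0\<^sub>m m n)"
  by (auto simp: integral_mat_def)

lemma integral_mat_transpose: "integral_mat A \<Longrightarrow> integral_mat (transpose_mat A)"
  by (auto simp: integral_mat_def)

lemma integral_mat_four_block:
  assumes "A \<in> carrier_mat a1 b1" "B \<in> carrier_mat a1 b2" "C \<in> carrier_mat a2 b1" "D \<in> carrier_mat a2 b2"
    "integral_mat A" "integral_mat B" "integral_mat C" "integral_mat D"
  shows "integral_mat (four_block_mat A B C D)"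
  using assms by (auto simp: integral_mat_def)

lemma v_det_nonneg: "A \<in> carrier_mat n n \<Longrightarrow> integral_mat A \<Longrightarrow> 0 \<le> v (det A)"
  by (subst det_def'[of _ n])
     (auto simp: v_mult v_prod integral_mat_def permutes_in_image sign_def intro!: v_sum_ge add_nonneg_nonneg sum_nonneg)

text \<open>
  These are the elements of \<open>GL\<^sub>n\<close> over the valuation ring, each given together with its inverse.
\<close>
definition integral_inverses :: "nat \<Rightarrow> 'k mat \<Rightarrow> 'k mat \<Rightarrow> bool" where
  "integral_inverses n P Q \<longleftrightarrow> P \<in> carrier_mat n n \<and> Q \<in> carrier_mat n n \<and>
     integral_mat P \<and> integral_mat Q \<and> P * Q = 1\<^sub>m n \<and> Q * P = 1\<^sub>m n"

lemma integral_inverses_sym: "integral_inverses n P Q \<Longrightarrow> integral_inverses n Q P"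
  by (auto simp: integral_inverses_def)

lemma integral_inverses_one: "integral_inverses n (1\<^sub>m n) (1\<^sub>m n)"
  by (auto simp: integral_inverses_def)

lemma mat_mult_cancel_middle:
  fixes P :: "'k mat"
  assumes "P \<in> carrier_mat n n" "P' \<in> carrier_mat n n" "Q \<in> carrier_mat n n" "Q' \<in> carrier_mat n n"
    and "P' * Q' = 1\<^sub>m n" "P * Q = 1\<^sub>m n"
  shows "(P * P') * (Q' * Q) = 1\<^sub>m n"
proof -
  have "(P * P') * (Q' * Q) = P * (P' * (Q' * Q))" using assms by (intro assoc_mult_mat) auto
  also have "P' * (Q' * Q) = (P' * Q') * Q" using assms by (intro assoc_mult_mat[symmetric]) auto
  finally show ?thesis using assms by simp
qed

lemma integral_inverses_mult:
  assumes "integral_inverses n P Q" "integral_inverses n P' Q'"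
  shows "integral_inverses n (P * P') (Q' * Q)"
  using assms mat_mult_cancel_middle[of P n P' Q Q'] mat_mult_cancel_middle[of Q' n Q P' P]
  by (auto simp: integral_inverses_def intro: integral_mat_mult)

lemma integral_inverses_transpose:
  assumes "integral_inverses n P Q"
  shows "integral_inverses n (transpose_mat P) (transpose_mat Q)"
  using assms unfolding integral_inverses_def
  by (metis integral_mat_transpose transpose_carrier_mat transpose_mult transpose_one)

lemma integral_inverses_four_block:
  assumes "integral_inverses n P Q"
  shows "integral_inverses (Suc n) (four_block_mat (1\<^sub>m 1) (0\<^sub>m 1 n) (0\<^sub>m n 1) P)
                                   (four_block_mat (1\<^sub>m 1) (0\<^sub>m 1 n) (0\<^sub>m n 1) Q)"
proof -
  have P: "P \<in> carrier_mat n n" "Q \<in> carrier_mat n n" and i: "integral_mat P" "integral_mat Q"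
    and PQ: "P * Q = 1\<^sub>m n" "Q * P = 1\<^sub>m n"
    using assms by (auto simp: integral_inverses_def)
  have one: "four_block_mat (1\<^sub>m 1) (0\<^sub>m 1 n) (0\<^sub>m n 1) (1\<^sub>m n) = (1\<^sub>m (Suc n) :: 'k mat)"
    using four_block_one_mat[of 1 n] by simp
  show ?thesis
    unfolding integral_inverses_def using P i PQ one
    by (auto simp: mult_four_block_mat[of _ 1 1 _ n _ n _ _ 1 _ n] intro!: integral_mat_four_block
        four_block_carrier_mat[of _ 1 1 _ n n, simplified])
qed

lemma integral_inverses_swap:
  assumes "i < n" "j < n"
  shows "integral_inverses n (swaprows_mat n i j) (swaprows_mat n i j)"
  using assms swaprows_mat_inv[OF assms]
  by (auto simp: integral_inverses_def integral_mat_def)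

lemma integral_inverses_shear:
  assumes U: "U \<in> carrier_mat n 1" and int: "integral_mat U"
  shows "integral_inverses (Suc n) (four_block_mat (1\<^sub>m 1) (0\<^sub>m 1 n) U (1\<^sub>m n))
                                   (four_block_mat (1\<^sub>m 1) (0\<^sub>m 1 n) (- U) (1\<^sub>m n))"
proof -
  have one: "four_block_mat (1\<^sub>m 1) (0\<^sub>m 1 n) (0\<^sub>m n 1) (1\<^sub>m n) = (1\<^sub>m (Suc n) :: 'k mat)"
    using four_block_one_mat[of 1 n] by simp
  have "integral_mat (- U)" using int by (auto simp: integral_mat_def)
  moreover have "U + - U = 0\<^sub>m n 1" "- U + U = 0\<^sub>m n 1" using U by (auto intro!: eq_matI)
  moreover have "1\<^sub>m (Suc 0) + - 0\<^sub>m (Suc 0) (Suc 0) = (1\<^sub>m (Suc 0) :: 'k mat)" by (auto intro!: eq_matI)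
  ultimately show ?thesis
    unfolding integral_inverses_def using U int one
    by (auto simp: mult_four_block_mat[of _ 1 1 _ n _ n _ _ 1 _ n] intro!: integral_mat_four_block
        four_block_carrier_mat[of _ 1 1 _ n n, simplified])
qed

section \<open>Normal forms under integral changes of basis\<close>

text \<open>
  A nonzero vector divided by an entry of least valuation is part of a basis over the valuation
  ring: a permutation moves this entry to the top, and the other entries are cleared by an integral
  shear.  The normal forms below all arise by applying this to a column or a row and recursing on the
  remaining block.
\<close>
lemma exists_integral_completion:
  assumes w: "w \<in> carrier_vec (Suc n)" "w \<noteq> 0\<^sub>v (Suc n)"
  obtains P Q j where "integral_inverses (Suc n) P Q" "j < Suc n" "w $ j \<noteq> 0"
    "\<And>k. k < Suc n \<Longrightarrow> v (w $ j) \<le> v (w $ k)" "Q *\<^sub>v w = w $ j \<cdot>\<^sub>v unit_vec (Suc n) 0"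
proof -
  have "Min ((\<lambda>k. v (w $ k)) ` {..n}) \<in> (\<lambda>k. v (w $ k)) ` {..n}" by (intro Min_in) auto
  then obtain j where "j \<in> {..n}" "Min ((\<lambda>k. v (w $ k)) ` {..n}) = v (w $ j)" by (rule imageE)
  then have j: "j \<le> n" "v (w $ j) = Min ((\<lambda>k. v (w $ k)) ` {..n})" by auto
  have min: "v (w $ j) \<le> v (w $ k)" if "k < Suc n" for k using that j by auto
  have nz: "w $ j \<noteq> 0"
  proof
    assume "w $ j = 0"
    then have "w $ k = 0" if "k < Suc n" for k using min[OF that] by simp
    then have "w = 0\<^sub>v (Suc n)" using w by (intro eq_vecI) auto
    then show False using w by simp
  qed
  define S where "S = (swaprows_mat (Suc n) 0 j :: 'k mat)"
  define w' where "w' = vec (Suc n) (\<lambda>i. w $ (if i = 0 then j else if i = j then 0 else i))"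
  have w': "w' \<in> carrier_vec (Suc n)" "w' $ 0 = w $ j" by (auto simp: w'_def)
  have S: "integral_inverses (Suc n) S S" unfolding S_def using j(1) by (intro integral_inverses_swap) auto
  have Sw: "S *\<^sub>v w = w'"
  proof (intro eq_vecI)
    fix i assume i: "i < dim_vec w'"
    then have i: "i < Suc n" by (simp add: w'_def)
    have "row S i = unit_vec (Suc n) (if i = 0 then j else if i = j then 0 else i)"
      using row_swaprows(2)[of i 0 j "Suc n"] row_swaprows(3,4)[of 0 "Suc n" j] i j(1)
      unfolding S_def by (cases "i = 0"; cases "i = j") simp_all
    then show "(S *\<^sub>v w) $ i = w' $ i"
      using i j(1) w by (simp add: w'_def S_def)
  qed (auto simp: w'_def S_def)
  define U where "U = mat n 1 (\<lambda>(k, _). - (w' $ Suc k / w $ j))"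
  have U: "U \<in> carrier_mat n 1" by (simp add: U_def)
  have intU: "integral_mat U"
    unfolding integral_mat_def
  proof (intro allI impI)
    fix i k assume ik: "i < dim_row U" "k < dim_col U"
    then have "v (w $ j) \<le> v (w' $ Suc i)" unfolding w'_def using min j(1) by (simp add: U_def)
    then show "0 \<le> v (U $$ (i, k))" using ik v_divide_nonneg[OF nz] by (simp add: U_def)
  qed
  define L where "L = four_block_mat (1\<^sub>m 1) (0\<^sub>m 1 n) U (1\<^sub>m n)"
  define L' where "L' = four_block_mat (1\<^sub>m 1) (0\<^sub>m 1 n) (- U) (1\<^sub>m n)"
  have LL: "integral_inverses (Suc n) L L'" unfolding L_def L'_def by (rule integral_inverses_shear[OF U intU])
  have Lw: "L *\<^sub>v w' = w $ j \<cdot>\<^sub>v unit_vec (Suc n) 0"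
  proof (intro eq_vecI)
    fix i assume "i < dim_vec (w $ j \<cdot>\<^sub>v unit_vec (Suc n) 0)"
    then have i: "i < Suc n" by simp
    have "(L *\<^sub>v w') $ i = (\<Sum>k = 0..<Suc n. L $$ (i, k) * w' $ k)"
      using i U w' by (auto simp: L_def scalar_prod_def)
    also have "\<dots> = L $$ (i, 0) * w $ j + (\<Sum>k = 0..<n. L $$ (i, Suc k) * w' $ Suc k)"
      using w' by (subst sum.atLeast0_lessThan_Suc_shift) simp
    also have "(\<Sum>k = 0..<n. L $$ (i, Suc k) * w' $ Suc k) = (\<Sum>k = 0..<n. if k = i - 1 then (if i = 0 then 0 else w' $ i) else 0)"
      using i U by (intro sum.cong) (auto simp: L_def)
    also have "L $$ (i, 0) * w $ j + \<dots> = (w $ j \<cdot>\<^sub>v unit_vec (Suc n) 0) $ i"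
      using i U nz by (cases i) (auto simp: L_def U_def)
    finally show "(L *\<^sub>v w') $ i = (w $ j \<cdot>\<^sub>v unit_vec (Suc n) 0) $ i" .
  qed (auto simp: L_def U_def)
  have "(L * S) *\<^sub>v w = L *\<^sub>v (S *\<^sub>v w)"
    using S LL w by (intro assoc_mult_mat_vec) (auto simp: integral_inverses_def)
  with Sw Lw have "(L * S) *\<^sub>v w = w $ j \<cdot>\<^sub>v unit_vec (Suc n) 0" by simp
  moreover have "integral_inverses (Suc n) (S * L') (L * S)"
    by (rule integral_inverses_mult[OF S integral_inverses_sym[OF LL]])
  ultimately show ?thesis using that j nz min by (metis less_Suc_eq_le)
qed

lemma four_block_split_first:
  assumes B: "B \<in> carrier_mat (Suc n) (Suc n)" 
  shows "B = four_block_mat (mat 1 1 (\<lambda>_. B $$ (0, 0))) (mat 1 n (\<lambda>(_, j). B $$ (0, Suc j)))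
     (mat n 1 (\<lambda>(i, _). B $$ (Suc i, 0))) (mat n n (\<lambda>(i, j). B $$ (Suc i, Suc j)))"
  using B by (intro eq_matI) auto

lemma four_block_split_first_col:
  assumes B: "B \<in> carrier_mat (Suc n) (Suc n)" and col: "\<And>i. i < n \<Longrightarrow> B $$ (Suc i, 0) = 0"
  shows "B = four_block_mat (mat 1 1 (\<lambda>_. B $$ (0, 0))) (mat 1 n (\<lambda>(_, j). B $$ (0, Suc j)))
     (0\<^sub>m n 1) (mat n n (\<lambda>(i, j). B $$ (Suc i, Suc j)))"
proof -
  have "mat n 1 (\<lambda>(i, _). B $$ (Suc i, 0)) = 0\<^sub>m n 1" using col by (intro eq_matI) auto
  then show ?thesis using four_block_split_first[OF B] by simp
qed

text \<open>
  An eigenvector for the first prescribed eigenvalue, scaled to be primitive, starts the integral basis; the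
  characteristic polynomial of the remaining block has the remaining linear factors.
\<close>
lemma integral_triangularization:
  assumes "A \<in> carrier_mat n n" "char_poly A = (\<Prod>a\<leftarrow>as. [:- a, 1:])"
  obtains P Q where "integral_inverses n P Q" "upper_triangular (Q * A * P)" "diag_mat (Q * A * P) = as"
proof -
  have "\<exists>P Q. integral_inverses n P Q \<and> upper_triangular (Q * A * P) \<and> diag_mat (Q * A * P) = as"
    using assms
  proof (induction n arbitrary: A as)
    case 0
    have "degree (char_poly A) = 0" using degree_monic_char_poly[OF 0(1)] by simp
    then have "as = []" using 0(2) degree_linear_factors[of uminus as] by simp
    then show ?case using 0
      by (intro exI[of _ "1\<^sub>m 0"]) (auto simp: integral_inverses_one diag_mat_def)
  next
    case (Suc n)
    note A = Suc(2)
    have "length as = Suc n" 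
      using degree_monic_char_poly[OF A] Suc(3) degree_linear_factors[of uminus as] by simp
    then obtain a as' where as: "as = a # as'" by (cases as) auto
    have "poly (char_poly A) a = 0" using Suc(3) as by simp
    then obtain w where w: "w \<in> carrier_vec (Suc n)" "w \<noteq> 0\<^sub>v (Suc n)" "A *\<^sub>v w = a \<cdot>\<^sub>v w"
      using eigenvalue_root_char_poly[OF A, of a] A by (auto simp: eigenvalue_def eigenvector_def)
    obtain P Q j where PQ: "integral_inverses (Suc n) P Q" and j: "w $ j \<noteq> 0"
      and Qw: "Q *\<^sub>v w = w $ j \<cdot>\<^sub>v unit_vec (Suc n) 0"
      using exists_integral_completion[OF w(1,2)] by metis
    have PQc: "P \<in> carrier_mat (Suc n) (Suc n)" "Q \<in> carrier_mat (Suc n) (Suc n)"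
      and PQ1: "P * Q = 1\<^sub>m (Suc n)" "Q * P = 1\<^sub>m (Suc n)" using PQ by (auto simp: integral_inverses_def)
    define e where "e = (unit_vec (Suc n) 0 :: 'k vec)"
    have e: "e \<in> carrier_vec (Suc n)" by (simp add: e_def)
    define B where "B = Q * A * P"
    have B: "B \<in> carrier_mat (Suc n) (Suc n)" using A PQc by (auto simp: B_def)
    have "w $ j \<cdot>\<^sub>v (P *\<^sub>v e) = P *\<^sub>v (Q *\<^sub>v w)"
      using PQc e unfolding Qw e_def[symmetric] by (simp add: mult_mat_vec)
    also have "\<dots> = w" using PQc w PQ1 by (metis assoc_mult_mat_vec one_mult_mat_vec)
    finally have Pe: "w $ j \<cdot>\<^sub>v (P *\<^sub>v e) = w" .
    have "w $ j \<cdot>\<^sub>v (B *\<^sub>v e) = Q *\<^sub>v (A *\<^sub>v (w $ j \<cdot>\<^sub>v (P *\<^sub>v e)))"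
      using PQc e A by (simp add: B_def mult_mat_vec[of _ "Suc n" "Suc n"] assoc_mult_mat_vec[of _ "Suc n" "Suc n" _ "Suc n"])
    also have "\<dots> = a \<cdot>\<^sub>v (Q *\<^sub>v w)" using Pe w PQc by (simp add: mult_mat_vec)
    also have "\<dots> = w $ j \<cdot>\<^sub>v (a \<cdot>\<^sub>v e)" using Qw by (simp add: e_def smult_smult_assoc mult.commute)
    finally have eq: "w $ j \<cdot>\<^sub>v (B *\<^sub>v e) = w $ j \<cdot>\<^sub>v (a \<cdot>\<^sub>v e)" .
    have Bcol: "B $$ (i, 0) = (if i = 0 then a else 0)" if "i < Suc n" for i
    proof -
      have "(w $ j \<cdot>\<^sub>v (B *\<^sub>v e)) $ i = w $ j * B $$ (i, 0)"
        using B that by (simp add: e_def)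
      then show ?thesis using j that unfolding eq by (simp add: e_def split: if_splits)
    qed
    define A2 where "A2 = mat 1 n (\<lambda>(_, j). B $$ (0, Suc j))"
    define A' where "A' = mat n n (\<lambda>(i, j). B $$ (Suc i, Suc j))"
    define A1 where "A1 = mat 1 1 (\<lambda>_. a)"
    have c: "A1 \<in> carrier_mat 1 1" "A2 \<in> carrier_mat 1 n" "A' \<in> carrier_mat n n" by (auto simp: A1_def A2_def A'_def)
    have Bb: "B = four_block_mat A1 A2 (0\<^sub>m n 1) A'"
      unfolding A1_def A2_def A'_def using four_block_split_first_col[OF B] Bcol by simp
    have "similar_mat B A" unfolding similar_mat_def similar_mat_wit_def Let_def
      using A PQc PQ1 B by (intro exI[of _ Q] exI[of _ P]) (auto simp: B_def)
    then have "char_poly A = char_poly A1 * char_poly A'"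
      using char_poly_similar[of B A] char_poly_four_block_zeros_col[OF c] Bb by simp
    moreover have "char_poly A1 = [:- a, 1:]"
      by (subst char_poly_upper_triangular[OF c(1)]) (auto simp: A1_def diag_mat_def)
    ultimately have "[:- a, 1:] * char_poly A' = [:- a, 1:] * (\<Prod>a\<leftarrow>as'. [:- a, 1:])"
      using Suc(3) unfolding as list.map prod_list.Cons by metis
    then have "char_poly A' = (\<Prod>a\<leftarrow>as'. [:- a, 1:])"
      unfolding mult_cancel_left by simp
    from Suc(1)[OF c(3) this] obtain P' Q' where P'Q': "integral_inverses n P' Q'"
      and tri: "upper_triangular (Q' * A' * P')" "diag_mat (Q' * A' * P') = as'" by auto
    have P'Q'c: "P' \<in> carrier_mat n n" "Q' \<in> carrier_mat n n" using P'Q' by (auto simp: integral_inverses_def)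
    define P'' where "P'' = four_block_mat (1\<^sub>m 1) (0\<^sub>m 1 n) (0\<^sub>m n 1) P'"
    define Q'' where "Q'' = four_block_mat (1\<^sub>m 1) (0\<^sub>m 1 n) (0\<^sub>m n 1) Q'"
    have PQ'': "integral_inverses (Suc n) P'' Q''"
      unfolding P''_def Q''_def by (rule integral_inverses_four_block[OF P'Q'])
    then have PQ''c: "P'' \<in> carrier_mat (Suc n) (Suc n)" "Q'' \<in> carrier_mat (Suc n) (Suc n)"
      by (auto simp: integral_inverses_def)
    have "(Q'' * Q) * A * (P * P'') = Q'' * B * P''"
      using PQc PQ''c A by (simp add: B_def assoc_mult_mat[of _ "Suc n" "Suc n" _ "Suc n" _ "Suc n"])
    also have "\<dots> = four_block_mat A1 (A2 * P') (0\<^sub>m n 1) (Q' * A' * P')"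
      unfolding Bb P''_def Q''_def using c P'Q'c
      by (simp add: mult_four_block_mat[of _ 1 1 _ n _ n _ _ 1 _ n])
    finally have eq: "(Q'' * Q) * A * (P * P'') = four_block_mat A1 (A2 * P') (0\<^sub>m n 1) (Q' * A' * P')" .
    have "upper_triangular ((Q'' * Q) * A * (P * P''))"
      unfolding eq using c P'Q'c tri by (intro upper_triangular_four_block[of _ 1 _ n]) (auto simp: A1_def)
    moreover have "diag_mat ((Q'' * Q) * A * (P * P'')) = as"
      unfolding eq using c P'Q'c tri by (subst diag_four_block_mat[of _ 1 _ n]) (auto simp: as A1_def diag_mat_def)
    ultimately show ?case using integral_inverses_mult[OF PQ PQ''] by blast
  qed
  then show ?thesis using that by blast
qed

text \<open>
  In other words \<open>GL\<^sub>n\<close> of the field is the product of \<open>GL\<^sub>n\<close> of the valuation ring and the group of upper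
  triangular matrices.
\<close>
lemma Iwasawa_decomposition:
  assumes "G \<in> carrier_mat n n" "det G \<noteq> 0"
  obtains P Q where "integral_inverses n P Q" "upper_triangular (Q * G)"
proof -
  have "\<exists>P Q. integral_inverses n P Q \<and> upper_triangular (Q * G)"
    using assms
  proof (induction n arbitrary: G)
    case 0 then show ?case
      by (intro exI[of _ "1\<^sub>m 0"]) (auto simp: integral_inverses_one)
  next
    case (Suc n)
    note G = Suc(2)
    define w where "w = col G 0"
    have w: "w \<in> carrier_vec (Suc n)" using G unfolding w_def by (metis carrier_matD(1) carrier_vec_dim_vec dim_col)
    have "w \<noteq> 0\<^sub>v (Suc n)"
    proof
      assume w0: "w = 0\<^sub>v (Suc n)"
      have "G *\<^sub>v unit_vec (Suc n) 0 = 0\<^sub>v (Suc n)" 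
      proof (intro eq_vecI)
        fix i assume "i < dim_vec (0\<^sub>v (Suc n) :: 'k vec)"
        then show "(G *\<^sub>v unit_vec (Suc n) 0) $ i = 0\<^sub>v (Suc n) $ i"
          using G arg_cong[OF w0, of "\<lambda>w. w $ i"] by (simp add: w_def)
      qed (use G in simp)
      moreover have "unit_vec (Suc n) 0 \<noteq> (0\<^sub>v (Suc n) :: 'k vec)" by (simp add: unit_vec_nonzero)
      ultimately show False using Suc(3) det_0_iff_vec_prod_zero_field[OF G] by force
    qed
    from exists_integral_completion[OF w this] obtain P Q j where
      PQ: "integral_inverses (Suc n) P Q" and Qw: "Q *\<^sub>v w = w $ j \<cdot>\<^sub>v unit_vec (Suc n) 0" by metis
    have PQc: "P \<in> carrier_mat (Suc n) (Suc n)" "Q \<in> carrier_mat (Suc n) (Suc n)"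
      and PQ1: "P * Q = 1\<^sub>m (Suc n)" "Q * P = 1\<^sub>m (Suc n)" using PQ by (auto simp: integral_inverses_def)
    define B where "B = Q * G"
    have B: "B \<in> carrier_mat (Suc n) (Suc n)" using G PQc by (auto simp: B_def)
    have "B $$ (Suc i, 0) = 0" if "i < n" for i
    proof -
      have "B $$ (Suc i, 0) = (Q *\<^sub>v w) $ Suc i" using that PQc G by (simp add: B_def w_def)
      then show ?thesis using that unfolding Qw by simp
    qed
    note Bb = four_block_split_first_col[OF B this]
    define A2 where "A2 = mat 1 n (\<lambda>(_, j). B $$ (0, Suc j))"
    define A' where "A' = mat n n (\<lambda>(i, j). B $$ (Suc i, Suc j))"
    define A1 where "A1 = mat 1 1 (\<lambda>_. B $$ (0, 0))"
    have c: "A1 \<in> carrier_mat 1 1" "A2 \<in> carrier_mat 1 n" "A' \<in> carrier_mat n n" by (auto simp: A1_def A2_def A'_def)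
    have Bb: "B = four_block_mat A1 A2 (0\<^sub>m n 1) A'"
      unfolding A1_def A2_def A'_def using Bb by simp
    have "det Q * det P = 1" using det_mult[OF PQc(2,1)] PQ1 by simp
    then have "det Q \<noteq> 0" by auto
    then have "det B \<noteq> 0" using Suc(3) det_mult[OF PQc(2) G] by (simp add: B_def)
    moreover have "det B = det A1 * det A'"
      unfolding Bb by (rule det_four_block_mat_lower_left_zero_col[OF c(1,2) refl c(3)])
    ultimately have "det A' \<noteq> 0" by auto
    from Suc(1)[OF c(3) this] obtain P' Q' where P'Q': "integral_inverses n P' Q'"
      and tri: "upper_triangular (Q' * A')" by auto
    have P'Q'c: "P' \<in> carrier_mat n n" "Q' \<in> carrier_mat n n" using P'Q' by (auto simp: integral_inverses_def)
    define P'' where "P'' = four_block_mat (1\<^sub>m 1) (0\<^sub>m 1 n) (0\<^sub>m n 1) P'"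
    define Q'' where "Q'' = four_block_mat (1\<^sub>m 1) (0\<^sub>m 1 n) (0\<^sub>m n 1) Q'"
    have PQ'': "integral_inverses (Suc n) P'' Q''"
      unfolding P''_def Q''_def by (rule integral_inverses_four_block[OF P'Q'])
    then have PQ''c: "P'' \<in> carrier_mat (Suc n) (Suc n)" "Q'' \<in> carrier_mat (Suc n) (Suc n)"
      by (auto simp: integral_inverses_def)
    have "(Q'' * Q) * G = Q'' * B"
      using PQc PQ''c G by (simp add: B_def assoc_mult_mat[of _ "Suc n" "Suc n" _ "Suc n" _ "Suc n"])
    also have "\<dots> = four_block_mat A1 A2 (0\<^sub>m n 1) (Q' * A')"
      unfolding Bb Q''_def using c P'Q'c
      by (simp add: mult_four_block_mat[of _ 1 1 _ n _ n _ _ 1 _ n])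
    finally have eq: "(Q'' * Q) * G = four_block_mat A1 A2 (0\<^sub>m n 1) (Q' * A')" .
    have "upper_triangular ((Q'' * Q) * G)"
      unfolding eq using c P'Q'c tri by (intro upper_triangular_four_block[of _ 1 _ n]) (auto simp: A1_def)
    then show ?case using integral_inverses_mult[OF PQ PQ''] by blast
  qed
  then show ?thesis using that by blast
qed

lemma v_integral_mult_ge:
  assumes "A \<in> carrier_mat a n" "B \<in> carrier_mat n b" "integral_mat A"
    and "\<And>i j. i < n \<Longrightarrow> j < b \<Longrightarrow> c \<le> v (B $$ (i, j))" "i < a" "j < b"
  shows "c \<le> v ((A * B) $$ (i, j))"
proof (rule v_mat_mult_ge[OF assms(1,2,5,6)])
  fix k assume "k < n"
  then have "0 + c \<le> v (A $$ (i, k)) + v (B $$ (k, j))"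
    using assms by (intro add_mono integral_matD[OF assms(3,1)]) auto
  then show "c \<le> v (A $$ (i, k)) + v (B $$ (k, j))" by simp
qed

lemma v_mult_integral_ge:
  assumes "A \<in> carrier_mat a n" "B \<in> carrier_mat n b" "integral_mat B"
    and "\<And>i j. i < a \<Longrightarrow> j < n \<Longrightarrow> c \<le> v (A $$ (i, j))" "i < a" "j < b"
  shows "c \<le> v ((A * B) $$ (i, j))"
proof (rule v_mat_mult_ge[OF assms(1,2,5,6)])
  fix k assume "k < n"
  then have "c + 0 \<le> v (A $$ (i, k)) + v (B $$ (k, j))"
    using assms by (intro add_mono integral_matD[OF assms(3,2)]) auto
  then show "c \<le> v (A $$ (i, k)) + v (B $$ (k, j))" by simp
qed

text \<open>
  An entry of least valuation among all entries divides the others, so its row and its column can be cleared by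
  integral operations; the remaining block still has entries of at least this valuation, so the
  valuations of the diagonal entries come out in non-decreasing order.
\<close>
lemma Smith_decomposition:
  assumes "A \<in> carrier_mat n n"
  obtains P P' Q Q' where "integral_inverses n P P'" "integral_inverses n Q Q'" "diagonal_mat (P * A * Q)"
    "\<And>i j. i \<le> j \<Longrightarrow> j < n \<Longrightarrow> v ((P * A * Q) $$ (i, i)) \<le> v ((P * A * Q) $$ (j, j))"
proof -
  have "\<exists>P P' Q Q'. integral_inverses n P P' \<and> integral_inverses n Q Q' \<and> diagonal_mat (P * A * Q) \<and>
     (\<forall>i j. i \<le> j \<longrightarrow> j < n \<longrightarrow> v ((P * A * Q) $$ (i, i)) \<le> v ((P * A * Q) $$ (j, j)))"
    using assms
  proof (induction n arbitrary: A)
    case 0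
    then show ?case
      by (intro exI[of _ "1\<^sub>m 0"]) (auto simp: integral_inverses_one diagonal_mat_def)
  next
    case (Suc n)
    note A = Suc(2)
    show ?case
    proof (cases "A = 0\<^sub>m (Suc n) (Suc n)")
      case True
      then show ?thesis
        by (intro exI[of _ "1\<^sub>m (Suc n)"]) (auto simp: integral_inverses_one diagonal_mat_def)
    next
      case False
      let ?val = "\<lambda>(i, j). v (A $$ (i, j))"
      have "Min (?val ` ({..n} \<times> {..n})) \<in> ?val ` ({..n} \<times> {..n})" by (intro Min_in) auto
      then obtain ij where ij0: "ij \<in> {..n} \<times> {..n}" "Min (?val ` ({..n} \<times> {..n})) = ?val ij" by (rule imageE)
      define i0 j0 where "i0 = fst ij" and "j0 = snd ij"
      have ij: "i0 \<le> n" "j0 \<le> n" "v (A $$ (i0, j0)) = Min (?val ` ({..n} \<times> {..n}))"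
        using ij0 by (auto simp: i0_def j0_def split_beta)
      have min: "v (A $$ (i0, j0)) \<le> v (A $$ (i, j))" if "i < Suc n" "j < Suc n" for i j
        unfolding ij(3) using that by (intro Min_le) (auto intro!: image_eqI[of _ _ "(i, j)"])
      have nz: "A $$ (i0, j0) \<noteq> 0"
      proof
        assume "A $$ (i0, j0) = 0"
        then have "A $$ (i, j) = 0" if "i < Suc n" "j < Suc n" for i j using min[OF that] by simp
        then have "A = 0\<^sub>m (Suc n) (Suc n)" using A by (intro eq_matI) auto
        then show False using False by simp
      qed
      define S where "S = (swaprows_mat (Suc n) 0 i0 :: 'k mat)"
      have S: "integral_inverses (Suc n) S S" unfolding S_def using ij(1) by (intro integral_inverses_swap) auto
      define w where "w = row A i0"
      have w: "w \<in> carrier_vec (Suc n)" using A unfolding w_def by (intro carrier_vecI) simp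
      have "w $ j0 \<noteq> 0" using A ij(1,2) nz by (simp add: w_def)
      then have "w \<noteq> 0\<^sub>v (Suc n)" using ij(2) by auto
      from exists_integral_completion[OF w this] obtain P Q j where
        PQ: "integral_inverses (Suc n) P Q" and j: "j < Suc n" "w $ j \<noteq> 0"
        "\<And>k. k < Suc n \<Longrightarrow> v (w $ j) \<le> v (w $ k)" and
        Qw: "Q *\<^sub>v w = w $ j \<cdot>\<^sub>v unit_vec (Suc n) 0" by metis
      define c where "c = w $ j"
      have cmin: "v c \<le> v (A $$ (i, k))" if "i < Suc n" "k < Suc n" for i k
        using j(3)[of j0] min[OF that] A ij(1,2) by (auto simp: w_def c_def)
      define Qt where "Qt = transpose_mat Q"
      define Pt where "Pt = transpose_mat P"
      have QtPt: "integral_inverses (Suc n) Qt Pt"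
        unfolding Qt_def Pt_def by (rule integral_inverses_transpose[OF integral_inverses_sym[OF PQ]])
      have carr: "S \<in> carrier_mat (Suc n) (Suc n)" "Q \<in> carrier_mat (Suc n) (Suc n)" "Qt \<in> carrier_mat (Suc n) (Suc n)"
        and intg: "integral_mat S" "integral_mat Qt"
        using S PQ QtPt by (auto simp: integral_inverses_def)
      define B where "B = S * A * Qt"
      have B: "B \<in> carrier_mat (Suc n) (Suc n)" using A carr by (auto simp: B_def)
      have Bge: "v c \<le> v (B $$ (i, k))" if "i < Suc n" "k < Suc n" for i k
        unfolding B_def using carr A intg that cmin
        by (intro v_mult_integral_ge[of _ "Suc n" "Suc n" _ "Suc n"] v_integral_mult_ge[of _ "Suc n" "Suc n" _ "Suc n"]) auto
      have rowSA: "row (S * A) 0 = w"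
      proof -
        have "S * A = swaprows 0 i0 A" unfolding S_def using A ij(1,2) by (intro swaprows_mat[symmetric]) auto
        then show ?thesis using A ij(1,2) by (auto simp: w_def intro!: eq_vecI)
      qed
      have Brow: "B $$ (0, k) = (if k = 0 then c else 0)" if "k < Suc n" for k
      proof -
        have "B $$ (0, k) = w \<bullet> row Q k"
          unfolding B_def using that carr A by (subst index_mult_mat(1)) (auto simp: rowSA Qt_def simp del: index_mult_mat(1) row_mult)
        also have "\<dots> = (Q *\<^sub>v w) $ k" using that carr w by (simp add: comm_scalar_prod[of w "Suc n"])
        finally show ?thesis using that unfolding Qw by (simp add: c_def)
      qed
      define U where "U = mat n 1 (\<lambda>(i, _). - (B $$ (Suc i, 0) / c))"
      have U: "U \<in> carrier_mat n 1" by (simp add: U_def)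
      have intU: "integral_mat U"
        using Bge j by (auto simp: integral_mat_def U_def c_def intro!: v_divide_nonneg)
      define L where "L = four_block_mat (1\<^sub>m 1) (0\<^sub>m 1 n) U (1\<^sub>m n)"
      define L' where "L' = four_block_mat (1\<^sub>m 1) (0\<^sub>m 1 n) (- U) (1\<^sub>m n)"
      have LL: "integral_inverses (Suc n) L L'" unfolding L_def L'_def by (rule integral_inverses_shear[OF U intU])
      define C where "C = mat 1 1 (\<lambda>_. c)"
      define V where "V = mat n 1 (\<lambda>(i, _). B $$ (Suc i, 0))"
      define A' where "A' = mat n n (\<lambda>(i, j). B $$ (Suc i, Suc j))"
      have c: "C \<in> carrier_mat 1 1" "V \<in> carrier_mat n 1" "A' \<in> carrier_mat n n" by (auto simp: C_def V_def A'_def)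
      have Bb: "B = four_block_mat C (0\<^sub>m 1 n) V A'"
        unfolding C_def V_def A'_def using B Brow by (intro eq_matI) auto
      have "U * C + V = 0\<^sub>m n 1" using j 
        by (intro eq_matI) (auto simp: U_def C_def V_def scalar_prod_def c_def)
      then have LB: "L * B = four_block_mat C (0\<^sub>m 1 n) (0\<^sub>m n 1) A'"
        unfolding L_def Bb using c U by (simp add: mult_four_block_mat[of _ 1 1 _ n _ n _ _ 1 _ n])
      from Suc(1)[OF c(3)] obtain P1 P1' Q1 Q1' where
        P1: "integral_inverses n P1 P1'" and Q1: "integral_inverses n Q1 Q1'" and
        dg: "diagonal_mat (P1 * A' * Q1)" and 
        srt: "\<And>i j. i \<le> j \<Longrightarrow> j < n \<Longrightarrow> v ((P1 * A' * Q1) $$ (i, i)) \<le> v ((P1 * A' * Q1) $$ (j, j))" by auto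
      have P1c: "P1 \<in> carrier_mat n n" "Q1 \<in> carrier_mat n n" and P1i: "integral_mat P1" "integral_mat Q1"
        using P1 Q1 by (auto simp: integral_inverses_def)
      define D where "D = P1 * A' * Q1"
      have D: "D \<in> carrier_mat n n" using P1c c by (auto simp: D_def)
      have Dge: "v c \<le> v (D $$ (i, k))" if "i < n" "k < n" for i k
        unfolding D_def using P1c c P1i that Bge
        by (intro v_mult_integral_ge[of _ n n _ n] v_integral_mult_ge[of _ n n _ n]) (auto simp: A'_def)
      define P2 where "P2 = four_block_mat (1\<^sub>m 1) (0\<^sub>m 1 n) (0\<^sub>m n 1) P1"
      define P2' where "P2' = four_block_mat (1\<^sub>m 1) (0\<^sub>m 1 n) (0\<^sub>m n 1) P1'"
      define Q2 where "Q2 = four_block_mat (1\<^sub>m 1) (0\<^sub>m 1 n) (0\<^sub>m n 1) Q1"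
      define Q2' where "Q2' = four_block_mat (1\<^sub>m 1) (0\<^sub>m 1 n) (0\<^sub>m n 1) Q1'"
      have P2: "integral_inverses (Suc n) P2 P2'" and Q2: "integral_inverses (Suc n) Q2 Q2'"
        unfolding P2_def P2'_def Q2_def Q2'_def by (intro integral_inverses_four_block P1 Q1)+
      have carr2: "P2 \<in> carrier_mat (Suc n) (Suc n)" "Q2 \<in> carrier_mat (Suc n) (Suc n)" "L \<in> carrier_mat (Suc n) (Suc n)"
        using P2 Q2 LL by (auto simp: integral_inverses_def)
      have "(P2 * (L * S)) * A * (Qt * Q2) = P2 * (L * B) * Q2"
        unfolding B_def using carr carr2 A by (simp add: assoc_mult_mat[of _ "Suc n" "Suc n" _ "Suc n" _ "Suc n"])
      also have "\<dots> = four_block_mat C (0\<^sub>m 1 n) (0\<^sub>m n 1) D"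
        unfolding LB P2_def Q2_def D_def using c P1c
        by (simp add: mult_four_block_mat[of _ 1 1 _ n _ n _ _ 1 _ n])
      finally have eq: "(P2 * (L * S)) * A * (Qt * Q2) = four_block_mat C (0\<^sub>m 1 n) (0\<^sub>m n 1) D" .
      have "diagonal_mat ((P2 * (L * S)) * A * (Qt * Q2))"
        unfolding eq using dg c D by (auto simp: diagonal_mat_def D_def[symmetric])
      moreover have "\<forall>i j. i \<le> j \<longrightarrow> j < Suc n \<longrightarrow> v (((P2 * (L * S)) * A * (Qt * Q2)) $$ (i, i)) \<le> v (((P2 * (L * S)) * A * (Qt * Q2)) $$ (j, j))"
        unfolding eq using srt Dge c D by (auto simp: D_def[symmetric] C_def)
      ultimately show ?thesis
        using integral_inverses_mult[OF P2 integral_inverses_mult[OF LL S]] integral_inverses_mult[OF QtPt Q2]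
        by blast
    qed
  qed
  then show ?thesis using that by blast
qed

section \<open>Valuations of minors\<close>

text \<open>
  All \<open>i \<times> i\<close> minors of \<open>A\<close> have valuation at least \<open>c\<close>.  An actual minor is the case in which \<open>B\<close> and \<open>C\<close>
  select rows and columns; admitting all integral \<open>B\<close> and \<open>C\<close> is an equivalent condition, and it makes the
  behaviour under integral multiplications immediate.
\<close>
definition minors_ge :: "nat \<Rightarrow> 'g extended \<Rightarrow> 'k mat \<Rightarrow> bool" where
  "minors_ge i c A \<longleftrightarrow> (\<forall>B C. B \<in> carrier_mat i (dim_row A) \<longrightarrow> C \<in> carrier_mat (dim_col A) i \<longrightarrow>
     integral_mat B \<longrightarrow> integral_mat C \<longrightarrow> c \<le> v (det (B * A * C)))"

lemma minors_geD:
  "minors_ge i c A \<Longrightarrow> A \<in> carrier_mat m n \<Longrightarrow> B \<in> carrier_mat i m \<Longrightarrow> C \<in> carrier_mat n i \<Longrightarrow>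
    integral_mat B \<Longrightarrow> integral_mat C \<Longrightarrow> c \<le> v (det (B * A * C))"
  by (auto simp: minors_ge_def)

lemma minors_ge_mult:
  assumes m: "minors_ge i c A" and A: "A \<in> carrier_mat n n"
    and L: "L \<in> carrier_mat n n" "integral_mat L" and R: "R \<in> carrier_mat n n" "integral_mat R"
  shows "minors_ge i c (L * A * R)"
  unfolding minors_ge_def
proof (intro allI impI)
  fix B C assume "B \<in> carrier_mat i (dim_row (L * A * R))" "C \<in> carrier_mat (dim_col (L * A * R)) i"
    and int: "integral_mat B" "integral_mat C"
  then have B: "B \<in> carrier_mat i n" and C: "C \<in> carrier_mat n i" using L R by auto
  have "B * (L * A * R) * C = (B * L) * A * (R * C)"
    using B C L A R by (simp add: assoc_mult_mat[of _ _ n _ n _ n] assoc_mult_mat[of _ _ n _ n _ i])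
  moreover have "c \<le> v (det ((B * L) * A * (R * C)))"
    using B C L A R int by (intro minors_geD[OF m A]) (auto intro: integral_mat_mult)
  ultimately show "c \<le> v (det (B * (L * A * R) * C))" by simp
qed

text \<open>
  Expanding the determinant by the rows of \<open>C\<close>, an injective choice \<open>g\<close> of rows contributes the factor
  \<open>D\<close>-entries at \<open>i\<close> distinct places, and the sum of the first \<open>i\<close> valuations is the least possible.
\<close>
lemma minors_ge_diagonal:
  assumes D: "D \<in> carrier_mat n n" "diagonal_mat D" and i: "i \<le> n"
    and sorted: "\<And>k l. k \<le> l \<Longrightarrow> l < n \<Longrightarrow> v (D $$ (k, k)) \<le> v (D $$ (l, l))"
  shows "minors_ge i (\<Sum>k<i. v (D $$ (k, k))) D"
  unfolding minors_ge_def
proof (intro allI impI)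
  fix B C assume "B \<in> carrier_mat i (dim_row D)" "C \<in> carrier_mat (dim_col D) i"
    and int: "integral_mat B" "integral_mat C"
  then have B: "B \<in> carrier_mat i n" and C: "C \<in> carrier_mat n i" using D by auto
  have BD: "B * D \<in> carrier_mat i n" using B D by simp
  have BD_entry: "(B * D) $$ (k, m) = B $$ (k, m) * D $$ (m, m)" if "k < i" "m < n" for k m
  proof -
    have "(B * D) $$ (k, m) = (\<Sum>l<n. if l = m then B $$ (k, m) * D $$ (m, m) else 0)"
      unfolding mat_mult_entry[OF B D(1) that]
      using D that by (intro sum.cong) (auto simp: diagonal_mat_def)
    then show ?thesis using that by simp
  qed
  show "(\<Sum>k<i. v (D $$ (k, k))) \<le> v (det (B * D * C))"
    unfolding det_mult_rectangular[OF BD C]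
  proof (rule v_sum_ge)
    fix g assume g: "g \<in> {0..<i} \<rightarrow>\<^sub>E {..<n}"
    then have gn: "g k < n" if "k < i" for k using that by (auto simp: PiE_iff)
    define M where "M = mat i i (\<lambda>(k, l). C $$ (g k, l))"
    have M: "M \<in> carrier_mat i i" by (simp add: M_def)
    show "(\<Sum>k<i. v (D $$ (k, k))) \<le> v ((\<Prod>k = 0..<i. (B * D) $$ (k, g k)) * det (mat i i (\<lambda>(k, l). C $$ (g k, l))))"
      unfolding M_def[symmetric]
    proof (cases "inj_on g {0..<i}")
      case True
      have "integral_mat M" using integral_matD[OF int(2) C] gn by (auto simp: integral_mat_def M_def)
      then have Mge: "0 \<le> v (det M)" by (rule v_det_nonneg[OF M])
      have "(\<Sum>k<i. v (D $$ (k, k))) \<le> (\<Sum>s\<in>g ` {0..<i}. v (D $$ (s, s)))"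
      proof -
        have "g ` {0..<i} \<subseteq> {..<n}" using gn by auto
        then show ?thesis
          using sum_first_le_sum_subset[of n "\<lambda>k. v (D $$ (k, k))" "g ` {0..<i}"] sorted True
          by (simp add: card_image)
      qed
      also have "\<dots> = (\<Sum>k = 0..<i. v (D $$ (g k, g k)))" using True by (simp add: sum.reindex)
      also have "\<dots> \<le> (\<Sum>k = 0..<i. v ((B * D) $$ (k, g k)))"
      proof (rule sum_mono)
        fix k assume k: "k \<in> {0..<i}"
        then have "0 + v (D $$ (g k, g k)) \<le> v (B $$ (k, g k)) + v (D $$ (g k, g k))"
          using gn by (intro add_right_mono integral_matD[OF int(1) B]) auto
        then show "v (D $$ (g k, g k)) \<le> v ((B * D) $$ (k, g k))"
          using k gn by (simp add: BD_entry v_mult del: index_mult_mat(1))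
      qed
      also have "\<dots> = v (\<Prod>k = 0..<i. (B * D) $$ (k, g k)) + 0" by (simp add: v_prod)
      also have "\<dots> \<le> v (\<Prod>k = 0..<i. (B * D) $$ (k, g k)) + v (det M)" by (intro add_left_mono Mge)
      finally show "(\<Sum>k<i. v (D $$ (k, k))) \<le> v ((\<Prod>k = 0..<i. (B * D) $$ (k, g k)) * det M)"
        by (simp add: v_mult)
    next
      case False
      then obtain k l where kl: "k < i" "l < i" "k \<noteq> l" "g k = g l" by (auto simp: inj_on_def)
      then have "row M k = row M l" by (auto simp: M_def intro!: eq_vecI)
      then have "det M = 0" using det_identical_rows[OF M kl(3,1,2)] by simp
      then show "(\<Sum>k<i. v (D $$ (k, k))) \<le> v ((\<Prod>k = 0..<i. (B * D) $$ (k, g k)) * det M)" by simp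
    qed
  qed
qed

lemma v_det_upper_triangular:
  assumes "M \<in> carrier_mat n n" "upper_triangular M"
  shows "v (det M) = (\<Sum>k<n. v (M $$ (k, k)))"
  using assms by (simp add: det_upper_triangular v_prod_list diag_mat_def comp_def interv_sum_list_conv_sum_set_nat atLeast0LessThan)

lemma minors_ge_upper_triangularD:
  assumes m: "minors_ge i c S" and S: "S \<in> carrier_mat n n" "upper_triangular S" and i: "i \<le> n"
  shows "c \<le> (\<Sum>k<i. v (S $$ (k, k)))"
proof -
  define B where "B = mat i n (\<lambda>(k, l). if k = l then 1 else 0 :: 'k)"
  define C where "C = mat n i (\<lambda>(k, l). if k = l then 1 else 0 :: 'k)"
  have B: "B \<in> carrier_mat i n" and C: "C \<in> carrier_mat n i" by (auto simp: B_def C_def)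
  have int: "integral_mat B" "integral_mat C" by (auto simp: integral_mat_def B_def C_def)
  have BS: "(B * S) $$ (k, l) = S $$ (k, l)" if "k < i" "l < n" for k l
  proof -
    have "(B * S) $$ (k, l) = (\<Sum>m<n. if m = k then S $$ (k, l) else 0)"
      unfolding mat_mult_entry[OF B S(1) that] using that i by (intro sum.cong) (auto simp: B_def)
    then show ?thesis using that i by simp
  qed
  have BSc: "B * S \<in> carrier_mat i n" using B S by simp
  have BSY: "(B * S * C) $$ (k, l) = S $$ (k, l)" if "k < i" "l < i" for k l
  proof -
    have "(B * S * C) $$ (k, l) = (\<Sum>m<n. if m = l then S $$ (k, l) else 0)"
      unfolding mat_mult_entry[OF BSc C that] using that i
      by (intro sum.cong) (auto simp: C_def BS simp del: index_mult_mat(1))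
    then show ?thesis using that i by simp
  qed
  have M: "B * S * C \<in> carrier_mat i i" using BSc C by simp
  have "upper_triangular (B * S * C)"
    using M i S by (intro upper_triangularI) (auto simp: BSY upper_triangularD simp del: index_mult_mat(1))
  then have "v (det (B * S * C)) = (\<Sum>k<i. v (S $$ (k, k)))"
    by (simp add: v_det_upper_triangular[OF M] BSY del: index_mult_mat(1))
  then show ?thesis using minors_geD[OF m S(1) B C int] by simp
qed

text \<open>
  The leading minor of the integral triangularization is the product of the first \<open>i\<close> entries of \<open>as\<close>.
\<close>
lemma minors_le_sum_slopes:
  assumes A: "A \<in> carrier_mat n n" and cp: "char_poly A = (\<Prod>a\<leftarrow>as. [:- a, 1:])"
    and m: "minors_ge i c A" and i: "i \<le> n"
  shows "c \<le> sum_list (take i (map v as))"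
proof -
  obtain P Q where PQ: "integral_inverses n P Q"
    and tri: "upper_triangular (Q * A * P)" "diag_mat (Q * A * P) = as"
    using integral_triangularization[OF A cp] .
  have PQc: "P \<in> carrier_mat n n" "Q \<in> carrier_mat n n" "integral_mat P" "integral_mat Q"
    using PQ by (auto simp: integral_inverses_def)
  have S: "Q * A * P \<in> carrier_mat n n" using PQc A by simp
  have "minors_ge i c (Q * A * P)" using minors_ge_mult[OF m A] PQc by simp
  from minors_ge_upper_triangularD[OF this S tri(1) i]
  have "c \<le> (\<Sum>k<i. v ((Q * A * P) $$ (k, k)))" .
  also have "\<dots> = (\<Sum>k<i. v (as ! k))"
    using i S unfolding tri(2)[symmetric] by (intro sum.cong) (auto simp: diag_mat_def)
  also have "\<dots> = sum_list (take i (map v as))"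
  proof -
    have "length as = n" using PQc A unfolding tri(2)[symmetric] by (simp add: diag_mat_def)
    then show ?thesis using i by (simp add: sum_list_sum_nth atLeast0LessThan)
  qed
  finally show ?thesis .
qed

lemma minors_ge_det:
  assumes A: "A \<in> carrier_mat n n"
  shows "minors_ge n (v (det A)) A"
  unfolding minors_ge_def
proof (intro allI impI)
  fix B C assume "B \<in> carrier_mat n (dim_row A)" "C \<in> carrier_mat (dim_col A) n"
    and int: "integral_mat B" "integral_mat C"
  then have BC: "B \<in> carrier_mat n n" "C \<in> carrier_mat n n" using A by auto
  have "v (det (B * A * C)) = v (det B) + v (det A) + v (det C)"
    using BC A det_mult[of "B * A" n C] det_mult[of B n A] by (simp add: v_mult)
  moreover have "0 + v (det A) + 0 \<le> v (det B) + v (det A) + v (det C)"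
    by (intro add_mono order_refl v_det_nonneg[OF BC(1) int(1)] v_det_nonneg[OF BC(2) int(2)])
  ultimately show "v (det A) \<le> v (det (B * A * C))" by simp
qed

lemma v_det_eq_sum_slopes:
  assumes A: "A \<in> carrier_mat n n" and cp: "char_poly A = (\<Prod>a\<leftarrow>as. [:- a, 1:])"
  shows "v (det A) = sum_list (map v as)"
proof -
  obtain P Q where PQ: "integral_inverses n P Q"
    and tri: "upper_triangular (Q * A * P)" "diag_mat (Q * A * P) = as"
    using integral_triangularization[OF A cp] .
  have PQc: "P \<in> carrier_mat n n" "Q \<in> carrier_mat n n" "Q * P = 1\<^sub>m n"
    using PQ by (auto simp: integral_inverses_def)
  have "det Q * det P = 1" using det_mult[OF PQc(2,1)] PQc(3) by simp
  moreover have "det (Q * A * P) = det A * (det Q * det P)"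
    using PQc A det_mult[of "Q * A" n P] det_mult[of Q n A] by (simp add: mult_ac)
  ultimately have "det A = det (Q * A * P)" by simp
  also have "\<dots> = prod_list as" using det_upper_triangular[OF tri(1), of n] PQc A tri(2) by simp
  finally show ?thesis by (simp add: v_prod_list)
qed

section \<open>The projection onto an invariant subspace\<close>

text \<open>
  The upper right block of \<open>E\<close> is shown to be integral entry by entry, from its lower left corner upwards and
  to the right.  Each entry appears in an \<open>r\<close>-minor of \<open>S\<close>, up to the unipotent base change that removes the
  entries treated before; the bound on this minor amounts to the integrality of the entry.  The strict inequality
  between slopes enters through \<open>v (S\<^sub>i\<^sub>i - S\<^sub>j\<^sub>j) = v S\<^sub>i\<^sub>i\<close>, and it also makes the bound finite, so that it can be
  cancelled.
\<close>
lemma triangular_projection_integral: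
  assumes S: "S \<in> carrier_mat n n" "upper_triangular S" and E: "E \<in> carrier_mat n n"
    and comm: "E * S = S * E" and r: "r \<le> n"
    and E_left: "\<And>k j. k < n \<Longrightarrow> j < r \<Longrightarrow> E $$ (k, j) = (if k = j then 1 else 0)"
    and E_bot: "\<And>k j. r \<le> k \<Longrightarrow> k < n \<Longrightarrow> j < n \<Longrightarrow> E $$ (k, j) = 0"
    and slopes: "\<And>i j. i < r \<Longrightarrow> r \<le> j \<Longrightarrow> j < n \<Longrightarrow> v (S $$ (i, i)) < v (S $$ (j, j))"
    and minors: "minors_ge r (\<Sum>k<r. v (S $$ (k, k))) S"
  shows "integral_mat E"
proof -
  have S0: "S $$ (k, l) = 0" if "l < k" "k < n" for k l
    using S that by (simp add: upper_triangularD)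
  have split: "(\<Sum>m<n. f m) = (\<Sum>m<r. f m) + (\<Sum>m=r..<n. f m)" for f :: "nat \<Rightarrow> 'k"
    using sum.atLeastLessThan_concat[of 0 r n f] r by (simp add: atLeast0LessThan)
  have commE: "S $$ (k, j) + (\<Sum>m=r..<n. E $$ (k, m) * S $$ (m, j)) = (\<Sum>m<r. S $$ (k, m) * E $$ (m, j))"
    if "k < r" "j < n" for k j
  proof -
    have k: "k < n" using that r by simp
    have "(E * S) $$ (k, j) = (\<Sum>m<r. E $$ (k, m) * S $$ (m, j)) + (\<Sum>m=r..<n. E $$ (k, m) * S $$ (m, j))"
      unfolding mat_mult_entry[OF E S(1) k that(2)] by (rule split)
    also have "(\<Sum>m<r. E $$ (k, m) * S $$ (m, j)) = (\<Sum>m<r. if m = k then S $$ (k, j) else 0)"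
      using k E_left by (intro sum.cong) auto
    also have "\<dots> = S $$ (k, j)" using that by simp
    finally have 1: "(E * S) $$ (k, j) = S $$ (k, j) + (\<Sum>m=r..<n. E $$ (k, m) * S $$ (m, j))" .
    have "(S * E) $$ (k, j) = (\<Sum>m<r. S $$ (k, m) * E $$ (m, j)) + (\<Sum>m=r..<n. S $$ (k, m) * E $$ (m, j))"
      unfolding mat_mult_entry[OF S(1) E k that(2)] by (rule split)
    also have "(\<Sum>m=r..<n. S $$ (k, m) * E $$ (m, j)) = 0"
      using E_bot that by (intro sum.neutral) auto
    finally show ?thesis using 1 comm by simp
  qed
  have main: "0 \<le> v (E $$ (i, j))" if "i < r" "r \<le> j" "j < n" for i j
    using that
  proof (induction "r - i + j" arbitrary: i j rule: less_induct)
    case less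
    note ij = less(2-4)
    \<comment> \<open>\<open>N\<close> is the known part of the block: rows from \<open>i\<close> down, columns up to \<open>j\<close>, without the entry in question.\<close>
    define N where "N k l = (if i \<le> k \<and> l \<le> j \<and> (k, l) \<noteq> (i, j) then E $$ (k, l) else 0)" for k l
    have N: "0 \<le> v (N k l)" if "k < r" "r \<le> l" "l < n" for k l
    proof (cases "i \<le> k \<and> l \<le> j \<and> (k, l) \<noteq> (i, j)")
      case True
      then have "r - k + l < r - i + j" using that ij by auto
      then show ?thesis using less(1)[of k l] that True by (simp add: N_def)
    qed (auto simp: N_def)
    \<comment> \<open>
      With \<open>P\<close> the unipotent matrix with blocks \<open>1, N, 0, 1\<close>, these are the first \<open>r\<close> rows of \<open>P\<close>, and the columns
      of \<open>P\<inverse>\<close> with indices \<open>0, \<dots>, r - 1\<close>, where column \<open>j\<close> stands in place of column \<open>i\<close>.  So \<open>B * S * C\<close> is a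
      minor of \<open>P S P\<inverse>\<close>.
    \<close>
    define B where "B = mat r n (\<lambda>(k, l). if l < r then (if k = l then 1 else 0) else N k l)"
    define C where "C = mat n r (\<lambda>(k, l). if l \<noteq> i then (if k = l then 1 else 0) else
        if k < r then - N k j else if k = j then 1 else 0)"
    have B: "B \<in> carrier_mat r n" and C: "C \<in> carrier_mat n r" by (auto simp: B_def C_def)
    have int: "integral_mat B" "integral_mat C" using N ij by (auto simp: integral_mat_def B_def C_def)
    define M where "M = B * S * C"
    have BSc: "B * S \<in> carrier_mat r n" using B S by simp
    have M: "M \<in> carrier_mat r r" using BSc C by (simp add: M_def)
    have BS: "(B * S) $$ (k, l) = S $$ (k, l) + (\<Sum>m=r..<n. N k m * S $$ (m, l))" if "k < r" "l < n" for k l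
    proof -
      have "(B * S) $$ (k, l) = (\<Sum>m<r. B $$ (k, m) * S $$ (m, l)) + (\<Sum>m=r..<n. B $$ (k, m) * S $$ (m, l))"
        unfolding mat_mult_entry[OF B S(1) that] by (rule split)
      also have "(\<Sum>m<r. B $$ (k, m) * S $$ (m, l)) = (\<Sum>m<r. if m = k then S $$ (k, l) else 0)"
        using that r by (intro sum.cong) (auto simp: B_def)
      also have "\<dots> = S $$ (k, l)" using that by simp
      also have "(\<Sum>m=r..<n. B $$ (k, m) * S $$ (m, l)) = (\<Sum>m=r..<n. N k m * S $$ (m, l))"
        using that by (intro sum.cong) (auto simp: B_def)
      finally show ?thesis .
    qed
    have BS_left: "(B * S) $$ (k, l) = S $$ (k, l)" if "k < r" "l < r" for k l
    proof -
      have "(\<Sum>m=r..<n. N k m * S $$ (m, l)) = 0" using that S0 by (intro sum.neutral) auto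
      then show ?thesis using BS[of k l] that r by simp
    qed
    have M_other: "M $$ (k, l) = S $$ (k, l)" if "k < r" "l < r" "l \<noteq> i" for k l
    proof -
      have "M $$ (k, l) = (\<Sum>m<n. if m = l then (B * S) $$ (k, l) else 0)"
        unfolding M_def mat_mult_entry[OF BSc C that(1,2)] using that r by (intro sum.cong) (auto simp: C_def)
      then show ?thesis using that r BS_left[of k l] by simp
    qed
    have M_col: "M $$ (k, i) = (\<Sum>m<r. S $$ (k, m) * (E $$ (m, j) - N m j)) - (\<Sum>m=r..<n. (E $$ (k, m) - N k m) * S $$ (m, j))"
      if "k < r" for k
    proof -
      have "M $$ (k, i) = (\<Sum>m<r. (B * S) $$ (k, m) * C $$ (m, i)) + (\<Sum>m=r..<n. (B * S) $$ (k, m) * C $$ (m, i))"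
        unfolding M_def mat_mult_entry[OF BSc C that ij(1)] by (rule split)
      also have "(\<Sum>m<r. (B * S) $$ (k, m) * C $$ (m, i)) = - (\<Sum>m<r. S $$ (k, m) * N m j)"
        unfolding sum_negf[symmetric] using that r ij BS_left
        by (intro sum.cong) (auto simp: C_def simp del: index_mult_mat(1))
      also have "(\<Sum>m=r..<n. (B * S) $$ (k, m) * C $$ (m, i)) = (\<Sum>m=r..<n. if m = j then (B * S) $$ (k, j) else 0)"
        using ij by (intro sum.cong) (auto simp: C_def simp del: index_mult_mat(1))
      also have "\<dots> = (B * S) $$ (k, j)" using ij by simp
      also have "\<dots> = S $$ (k, j) + (\<Sum>m=r..<n. N k m * S $$ (m, j))" using that ij by (intro BS) auto
      finally have *: "M $$ (k, i) = - (\<Sum>m<r. S $$ (k, m) * N m j) + (S $$ (k, j) + (\<Sum>m=r..<n. N k m * S $$ (m, j)))" .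
      have "S $$ (k, j) = (\<Sum>m<r. S $$ (k, m) * E $$ (m, j)) - (\<Sum>m=r..<n. E $$ (k, m) * S $$ (m, j))"
        using commE[OF that ij(3)] by (simp add: eq_diff_eq)
      then show ?thesis unfolding * by (simp add: algebra_simps sum_subtractf)
    qed
    have first: "(\<Sum>m<r. S $$ (k, m) * (E $$ (m, j) - N m j)) = (if k = i then S $$ (i, i) * E $$ (i, j) else 0)"
      if "i \<le> k" "k < r" for k
    proof -
      have "(\<Sum>m<r. S $$ (k, m) * (E $$ (m, j) - N m j)) = (\<Sum>m<r. if m = i then (if k = i then S $$ (i, i) * E $$ (i, j) else 0) else 0)"
      proof (intro sum.cong refl)
        fix m assume "m \<in> {..<r}"
        then show "S $$ (k, m) * (E $$ (m, j) - N m j) = (if m = i then (if k = i then S $$ (i, i) * E $$ (i, j) else 0) else 0)"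
          using that r S0[of m k] by (cases "m < k") (auto simp: N_def)
      qed
      then show ?thesis using ij by simp
    qed
    have second: "(\<Sum>m=r..<n. (E $$ (k, m) - N k m) * S $$ (m, j)) = (if k = i then E $$ (i, j) * S $$ (j, j) else 0)"
      if "i \<le> k" "k < r" for k
    proof -
      have "(\<Sum>m=r..<n. (E $$ (k, m) - N k m) * S $$ (m, j)) = (\<Sum>m=r..<n. if m = j then (if k = i then E $$ (i, j) * S $$ (j, j) else 0) else 0)"
      proof (intro sum.cong refl)
        fix m assume "m \<in> {r..<n}"
        then show "(E $$ (k, m) - N k m) * S $$ (m, j) = (if m = j then (if k = i then E $$ (i, j) * S $$ (j, j) else 0) else 0)"
          using that S0[of j m] by (cases "j < m") (auto simp: N_def)
      qed
      then show ?thesis using ij by simp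
    qed
    have M_low: "M $$ (k, i) = 0" if "i < k" "k < r" for k
      using M_col[OF that(2)] first[of k] second[of k] that by simp
    have M_diag: "M $$ (i, i) = E $$ (i, j) * (S $$ (i, i) - S $$ (j, j))"
      using M_col[OF ij(1)] first[of i] second[of i] ij by (simp add: algebra_simps)
    have "upper_triangular M"
    proof (rule upper_triangularI)
      fix k l assume kl: "l < k" "k < dim_row M"
      then show "M $$ (k, l) = 0" using M M_low M_other[of k l] S0[of l k] r by (cases "l = i") auto
    qed
    then have "v (det M) = (\<Sum>k<r. v (M $$ (k, k)))" by (rule v_det_upper_triangular[OF M])
    also have "\<dots> = v (M $$ (i, i)) + (\<Sum>k\<in>{..<r} - {i}. v (M $$ (k, k)))"
      using ij by (intro sum.remove) auto
    also have "(\<Sum>k\<in>{..<r} - {i}. v (M $$ (k, k))) = (\<Sum>k\<in>{..<r} - {i}. v (S $$ (k, k)))"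
      using M_other by (intro sum.cong) auto
    also have "v (M $$ (i, i)) = v (E $$ (i, j)) + v (S $$ (i, i))"
      unfolding M_diag v_mult using v_diff_eq[OF slopes[OF ij]] by simp
    also have "v (E $$ (i, j)) + v (S $$ (i, i)) + (\<Sum>k\<in>{..<r} - {i}. v (S $$ (k, k))) = v (E $$ (i, j)) + (\<Sum>k<r. v (S $$ (k, k)))"
      using ij by (subst sum.remove[of "{..<r}" i]) (auto simp: add.assoc)
    finally have "(\<Sum>k<r. v (S $$ (k, k))) \<le> v (E $$ (i, j)) + (\<Sum>k<r. v (S $$ (k, k)))"
      using minors_geD[OF minors S(1) B C int] by (simp add: M_def)
    moreover have "\<exists>a. (\<Sum>k<r. v (S $$ (k, k))) = Fin a"
    proof -
      have "(\<Prod>k<r. S $$ (k, k)) \<noteq> 0"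
        using slopes[OF _ ij(2,3)] by (force simp: prod_zero_iff)
      then show ?thesis using v_Fin by (simp add: v_prod[symmetric])
    qed
    ultimately show ?case by (cases "v (E $$ (i, j))") (auto simp: zero_extended_def)
  qed
  show ?thesis unfolding integral_mat_def
  proof (intro allI impI)
    fix i j assume "i < dim_row E" "j < dim_col E"
    then show "0 \<le> v (E $$ (i, j))"
      using E E_left[of i j] E_bot[of i j] main[of i j] by (cases "j < r"; cases "i < r") auto
  qed
qed

text \<open>
  Here \<open>G\<close> is any basis in which \<open>A\<close> is triangular and the projection is the standard one, \<open>J\<close>.  Writing
  \<open>G = P H\<close> with \<open>P\<close> integrally invertible and \<open>H\<close> upper triangular, conjugation by \<open>H\<close> keeps \<open>R\<close>
  triangular with the same diagonal and \<open>J\<close> block triangular with diagonal blocks 1 and 0, while conjugation by \<open>P\<close> preserves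
  integrality and the valuations of minors.
\<close>
lemma invariant_projection_integral:
  fixes r n :: nat
  defines "J \<equiv> mat n n (\<lambda>(i, j). if i = j \<and> i < r then 1 else 0 :: 'k)"
  assumes A: "A \<in> carrier_mat n n" and G: "G \<in> carrier_mat n n" and Gi: "Gi \<in> carrier_mat n n"
    and GGi: "G * Gi = 1\<^sub>m n" "Gi * G = 1\<^sub>m n"
    and R: "R \<in> carrier_mat n n" "upper_triangular R" and AG: "A * G = G * R" and JR: "J * R = R * J"
    and r: "r \<le> n"
    and slopes: "\<And>i j. i < r \<Longrightarrow> r \<le> j \<Longrightarrow> j < n \<Longrightarrow> v (R $$ (i, i)) < v (R $$ (j, j))"
    and minors: "minors_ge r (\<Sum>k<r. v (R $$ (k, k))) A"
  shows "integral_mat (G * J * Gi)"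
proof -
  have J: "J \<in> carrier_mat n n" by (simp add: J_def)
  have "det G * det Gi = 1" using det_mult[OF G Gi] GGi by simp
  then have "det G \<noteq> 0" by auto
  then obtain P Q where PQ: "integral_inverses n P Q" and H_ut: "upper_triangular (Q * G)"
    using Iwasawa_decomposition[OF G] by metis
  have PQc: "P \<in> carrier_mat n n" "Q \<in> carrier_mat n n" "integral_mat P" "integral_mat Q"
    and PQ1: "P * Q = 1\<^sub>m n" "Q * P = 1\<^sub>m n"
    using PQ by (auto simp: integral_inverses_def)
  define H where "H = Q * G"
  define Hi where "Hi = Gi * P"
  have H: "H \<in> carrier_mat n n" "upper_triangular H" using H_ut PQc G by (auto simp: H_def)
  have Hi: "Hi \<in> carrier_mat n n" using PQc Gi by (auto simp: Hi_def)
  note assoc = assoc_mult_mat[of _ n n _ n _ n]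
  have HHi: "Hi * H = 1\<^sub>m n" "H * Hi = 1\<^sub>m n"
    unfolding H_def Hi_def using mat_mult_cancel_middle PQc G Gi PQ1 GGi by auto
  have Hi_ut: "upper_triangular Hi" by (rule upper_triangular_inverse[OF H Hi HHi(1)])
  have cancel: "Hi * (H * Z) = Z" if "Z \<in> carrier_mat n n" for Z
    using assoc[OF Hi H(1) that] HHi that by simp
  have diagH: "H $$ (k, k) * Hi $$ (k, k) = 1" if "k < n" for k
    using upper_triangular_mult(2)[OF H Hi Hi_ut that] HHi that by simp
  define S where "S = H * R * Hi"
  define E where "E = H * J * Hi"
  have S: "S \<in> carrier_mat n n" and E: "E \<in> carrier_mat n n" using H Hi R J by (auto simp: S_def E_def)
  have HR: "H * R \<in> carrier_mat n n" "upper_triangular (H * R)"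
    using upper_triangular_mult(1)[OF H R] H R by auto
  have S_ut: "upper_triangular S" unfolding S_def by (rule upper_triangular_mult(1)[OF HR Hi Hi_ut])
  have S_diag: "S $$ (k, k) = R $$ (k, k)" if "k < n" for k
    unfolding S_def using upper_triangular_mult(2)[OF HR Hi Hi_ut that] upper_triangular_mult(2)[OF H R that] diagH[OF that]
    by (simp add: algebra_simps)
  have "A = A * (G * Gi)" using A GGi by simp
  also have "\<dots> = A * G * Gi" using A G Gi by (simp add: assoc)
  also have "\<dots> = G * R * Gi" unfolding AG ..
  finally have A_eq: "A = G * R * Gi" .
  have S_eq: "S = Q * A * P"
    unfolding A_eq S_def H_def Hi_def using PQc G Gi R by (simp add: assoc)
  have "E * S = H * (J * R) * Hi" "S * E = H * (R * J) * Hi"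
    unfolding S_def E_def using H(1) Hi R(1) J by (simp_all add: assoc cancel)
  then have comm: "E * S = S * E" using JR by simp
  have HJ: "(H * J) $$ (k, l) = (if l < r then H $$ (k, l) else 0)" if "k < n" "l < n" for k l
  proof -
    have "(H * J) $$ (k, l) = (\<Sum>m<n. if m = l then (if l < r then H $$ (k, l) else 0) else 0)"
      unfolding mat_mult_entry[OF H(1) J that] using that by (intro sum.cong) (auto simp: J_def)
    then show ?thesis using that by simp
  qed
  have HJc: "H * J \<in> carrier_mat n n" using H J by simp
  have E_entry: "E $$ (k, j) = (\<Sum>l<n. if l < r then H $$ (k, l) * Hi $$ (l, j) else 0)" if "k < n" "j < n" for k j
    unfolding E_def mat_mult_entry[OF HJc Hi that] using HJ that
    by (intro sum.cong) (auto simp del: index_mult_mat(1))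
  have E_left: "E $$ (k, j) = (if k = j then 1 else 0)" if "k < n" "j < r" for k j
  proof -
    have j: "j < n" using that r by simp
    have "E $$ (k, j) = (\<Sum>l<n. H $$ (k, l) * Hi $$ (l, j))"
      unfolding E_entry[OF that(1) j]
    proof (intro sum.cong refl)
      fix l assume "l \<in> {..<n}"
      then show "(if l < r then H $$ (k, l) * Hi $$ (l, j) else 0) = H $$ (k, l) * Hi $$ (l, j)"
        using upper_triangularD[OF Hi_ut, of j l] Hi that by (cases "l < r") auto
    qed
    also have "\<dots> = (H * Hi) $$ (k, j)" using mat_mult_entry[OF H(1) Hi that(1) j] by simp
    finally show ?thesis using HHi that j by simp
  qed
  have E_bot: "E $$ (k, j) = 0" if "r \<le> k" "k < n" "j < n" for k j
    unfolding E_entry[OF that(2,3)]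
  proof (intro sum.neutral ballI)
    fix l assume "l \<in> {..<n}"
    then show "(if l < r then H $$ (k, l) * Hi $$ (l, j) else 0) = 0"
      using upper_triangularD[OF H(2), of l k] H that by (cases "l < r") auto
  qed
  have "(\<Sum>k<r. v (S $$ (k, k))) = (\<Sum>k<r. v (R $$ (k, k)))"
    using S_diag r by (intro sum.cong) auto
  then have minorsS: "minors_ge r (\<Sum>k<r. v (S $$ (k, k))) S"
    unfolding S_eq using minors_ge_mult[OF minors A PQc(2,4,1,3)] by simp
  have "integral_mat E"
    by (rule triangular_projection_integral[OF S S_ut E comm r E_left E_bot _ minorsS])
       (use S_diag slopes r in auto)
  then have "integral_mat (P * E * Q)"
    using PQc E by (intro integral_mat_mult[of _ n n _ n]) auto
  moreover have "P * E * Q = G * J * Gi"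
  proof -
    have c: "P * (Q * Z) = Z" if "Z \<in> carrier_mat n n" for Z
      using assoc[OF PQc(1,2) that] PQ1 that by simp
    show ?thesis unfolding E_def H_def Hi_def using PQc G Gi J PQ1 by (simp add: assoc c)
  qed
  ultimately show ?thesis by simp
qed

end

section \<open>Coordinates with respect to lists of vectors\<close>

locale coordinate_space = vector_space scale
  for scale :: "'a::field \<Rightarrow> 'b::ab_group_add \<Rightarrow> 'b" (infixr "*s" 75)
begin

abbreviation lc :: "(nat \<Rightarrow> 'a) \<Rightarrow> 'b list \<Rightarrow> 'b" where "lc \<equiv> lin_comb scale"

text \<open>
  Column \<open>j\<close> of \<open>M\<close> expresses the \<open>j\<close>-th vector of \<open>ys\<close> in terms of \<open>xs\<close>.  Two lists instead of a linear map
  cover all matrices needed below: base changes, the matrix of \<open>T\<close> (with \<open>ys = map T xs\<close>) and generators of lattices.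
\<close>
definition coords :: "'b list \<Rightarrow> 'b list \<Rightarrow> 'a mat \<Rightarrow> bool" where
  "coords xs ys M \<longleftrightarrow> M \<in> carrier_mat (length xs) (length ys) \<and>
     (\<forall>j<length ys. ys ! j = lc (\<lambda>i. M $$ (i, j)) xs)"

definition lin_indep :: "'b list \<Rightarrow> bool" where
  "lin_indep xs \<longleftrightarrow> (\<forall>c. lc c xs = 0 \<longrightarrow> (\<forall>i<length xs. c i = 0))"

lemma lc_cong: "(\<And>i. i < length xs \<Longrightarrow> c i = d i) \<Longrightarrow> lc c xs = lc d xs"
  by (auto simp: lin_comb_def intro!: sum.cong)

lemma lc_diff: "lc (\<lambda>i. c i - d i) xs = lc c xs - lc d xs"
  by (simp add: lin_comb_def scale_left_diff_distrib sum_subtractf)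

lemma lc_add: "lc (\<lambda>i. c i + d i) xs = lc c xs + lc d xs"
  by (simp add: lin_comb_def scale_left_distrib sum.distrib)

lemma lc_scale: "lc (\<lambda>i. a * c i) xs = a *s lc c xs"
  by (simp add: lin_comb_def scale_sum_right)

lemma lc_0: "(\<And>i. i < length xs \<Longrightarrow> c i = 0) \<Longrightarrow> lc c xs = 0"
  by (simp add: lin_comb_def)

lemma lc_append: "lc c (xs @ ys) = lc c xs + lc (\<lambda>i. c (length xs + i)) ys"
proof -
  have "lc c (xs @ ys) = (\<Sum>i=0..<length xs. c i *s (xs @ ys) ! i) + (\<Sum>i=length xs..<length xs + length ys. c i *s (xs @ ys) ! i)"
    unfolding lin_comb_def by (simp add: sum.atLeastLessThan_concat flip: atLeast0LessThan)
  also have "(\<Sum>i=length xs..<length xs + length ys. c i *s (xs @ ys) ! i) = (\<Sum>i=0..<length ys. c (length xs + i) *s ys ! i)"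
    using sum.shift_bounds_nat_ivl[of "\<lambda>i. c i *s (xs @ ys) ! i" 0 "length xs" "length ys"]
    by (simp add: add.commute nth_append)
  also have "(\<Sum>i=0..<length xs. c i *s (xs @ ys) ! i) = (\<Sum>i=0..<length xs. c i *s xs ! i)"
    by (intro sum.cong) (auto simp: nth_append)
  finally show ?thesis by (simp add: lin_comb_def atLeast0LessThan)
qed

lemma lc_in_subspace: "subspace S \<Longrightarrow> set xs \<subseteq> S \<Longrightarrow> lc c xs \<in> S"
  unfolding lin_comb_def by (intro subspace_sum subspace_scale) auto

lemma lc_unit: "k < length xs \<Longrightarrow> lc (\<lambda>i. if i = k then 1 else 0) xs = xs ! k"
proof -
  assume k: "k < length xs"
  have "lc (\<lambda>i. if i = k then 1 else 0) xs = (\<Sum>i<length xs. if i = k then xs ! k else 0)"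
    unfolding lin_comb_def by (intro sum.cong) auto
  then show ?thesis using k by simp
qed

lemma span_lc:
  assumes "y \<in> span (set xs)"
  shows "\<exists>c. y = lc c xs"
  using assms
proof (induction rule: span_induct_alt)
  case base
  show ?case by (intro exI[of _ "\<lambda>_. 0"]) (simp add: lc_0)
next
  case (step a x y)
  then obtain k c where "k < length xs" "x = xs ! k" "y = lc c xs" by (auto simp: in_set_conv_nth)
  then have "a *s x + y = lc (\<lambda>i. a * (if i = k then 1 else 0) + c i) xs"
    by (simp only: lc_add lc_scale lc_unit)
  then show ?case by blast
qed

lemma coords_lc:
  assumes "coords xs ys M"
  shows "lc c ys = lc (\<lambda>i. \<Sum>j<length ys. M $$ (i, j) * c j) xs"
proof -
  have "lc c ys = (\<Sum>j<length ys. \<Sum>i<length xs. (M $$ (i, j) * c j) *s xs ! i)"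
    using assms unfolding coords_def lin_comb_def
    by (intro sum.cong) (auto simp: scale_sum_right mult.commute)
  also have "\<dots> = (\<Sum>i<length xs. \<Sum>j<length ys. (M $$ (i, j) * c j) *s xs ! i)" by (rule sum.swap)
  finally show ?thesis by (simp add: lin_comb_def scale_sum_left)
qed

lemma coords_mult_lc:
  assumes "coords xs ys M" "N \<in> carrier_mat (length ys) m" "j < m"
  shows "lc (\<lambda>i. N $$ (i, j)) ys = lc (\<lambda>i. (M * N) $$ (i, j)) xs"
  unfolding coords_lc[OF assms(1)] using assms
  by (intro lc_cong) (auto simp: coords_def mat_mult_entry[of _ "length xs" "length ys"] simp del: index_mult_mat(1))

lemma coords_trans: "coords xs ys M \<Longrightarrow> coords ys zs N \<Longrightarrow> coords xs zs (M * N)"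
  using coords_mult_lc[of xs ys M N "length zs"] by (auto simp: coords_def simp del: index_mult_mat(1))

lemma coords_cancel:
  "coords xs ys M \<Longrightarrow> N \<in> carrier_mat (length ys) (length zs) \<Longrightarrow> coords xs zs (M * N) \<Longrightarrow> coords ys zs N"
  using coords_mult_lc[of xs ys M N "length zs"] by (auto simp: coords_def simp del: index_mult_mat(1))

lemma coords_self: "coords xs xs (1\<^sub>m (length xs))"
  unfolding coords_def
proof (intro conjI allI impI)
  fix j assume j: "j < length xs"
  have "lc (\<lambda>i. 1\<^sub>m (length xs) $$ (i, j)) xs = lc (\<lambda>i. if i = j then 1 else 0) xs"
    using j by (intro lc_cong) auto
  then show "xs ! j = lc (\<lambda>i. 1\<^sub>m (length xs) $$ (i, j)) xs" using lc_unit[OF j] by simp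
qed simp

lemma lc_eq_iff_coeffs:
  assumes "lin_indep xs" "lc c xs = lc d xs" "i < length xs"
  shows "c i = d i"
  using assms lc_diff[of c d xs] unfolding lin_indep_def by fastforce

lemma coords_unique:
  assumes "lin_indep xs" "coords xs ys M" "coords xs ys N"
  shows "M = N"
proof (rule eq_matI)
  fix i j assume "i < dim_row N" "j < dim_col N"
  then have ij: "i < length xs" "j < length ys" using assms by (auto simp: coords_def)
  then have "lc (\<lambda>i. M $$ (i, j)) xs = lc (\<lambda>i. N $$ (i, j)) xs" using assms(2,3) unfolding coords_def by metis
  from lc_eq_iff_coeffs[OF assms(1) this ij(1)] show "M $$ (i, j) = N $$ (i, j)" .
qed (use assms in \<open>auto simp: coords_def\<close>)

lemma coords_exist:
  assumes "set ys \<subseteq> span (set xs)"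
  shows "\<exists>M. coords xs ys M"
proof -
  have "\<forall>j<length ys. \<exists>c. ys ! j = lc c xs" using assms span_lc by (auto simp: set_conv_nth)
  then obtain c where c: "\<And>j. j < length ys \<Longrightarrow> ys ! j = lc (c j) xs" by metis
  have "coords xs ys (mat (length xs) (length ys) (\<lambda>(i, j). c j i))"
    unfolding coords_def using c by (auto intro!: lc_cong)
  then show ?thesis by blast
qed

lemma lin_indep_coords:
  assumes "lin_indep xs" "coords xs ys M" "N \<in> carrier_mat (length ys) (length xs)" "N * M = 1\<^sub>m (length ys)"
  shows "lin_indep ys"
  unfolding lin_indep_def
proof (intro allI impI)
  fix c i assume c: "lc c ys = 0" and i: "i < length ys"
  have M: "M \<in> carrier_mat (length xs) (length ys)" using assms(2) by (simp add: coords_def)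
  define u where "u = vec (length ys) c"
  have u: "u \<in> carrier_vec (length ys)" by (simp add: u_def)
  have "M *\<^sub>v u = 0\<^sub>v (length xs)"
  proof (rule eq_vecI)
    fix k assume "k < dim_vec (0\<^sub>v (length xs) :: 'a vec)"
    then have k: "k < length xs" by simp
    have "(\<Sum>j<length ys. M $$ (k, j) * c j) = 0"
      using assms(1) c k unfolding coords_lc[OF assms(2)] lin_indep_def by blast
    then show "(M *\<^sub>v u) $ k = 0\<^sub>v (length xs) $ k"
      using k M by (simp add: u_def scalar_prod_def atLeast0LessThan)
  qed (use M in simp)
  then have "N *\<^sub>v (M *\<^sub>v u) = 0\<^sub>v (length ys)" using assms(3) by (auto intro!: eq_vecI)
  moreover have "N *\<^sub>v (M *\<^sub>v u) = u" using assoc_mult_mat_vec[OF assms(3) M u] assms(4) u by simp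
  ultimately have "u $ i = 0" using i by simp
  then show "c i = 0" using i by (simp add: u_def)
qed

lemma lin_indep_list: 
  assumes "distinct bs" "independent (set bs)"
  shows "lin_indep bs"
  unfolding lin_indep_def
proof (intro allI impI)
  fix c i assume c: "lc c bs = 0" and i: "i < length bs"
  have bij: "bij_betw ((!) bs) {..<length bs} (set bs)" by (rule bij_betw_nth[OF assms(1) refl refl])
  define u where "u = (\<lambda>b. c (the_inv_into {..<length bs} ((!) bs) b))"
  have u: "u (bs ! k) = c k" if "k < length bs" for k
    unfolding u_def using that bij by (subst the_inv_into_f_f) (auto simp: bij_betw_def)
  have "(\<Sum>b\<in>set bs. u b *s b) = (\<Sum>k<length bs. u (bs ! k) *s bs ! k)"
    by (rule sum.reindex_bij_betw[OF bij, symmetric])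
  also have "\<dots> = lc c bs" unfolding lin_comb_def using u by (intro sum.cong) auto
  finally have "(\<Sum>b\<in>set bs. u b *s b) = 0" using c by simp
  then have "u (bs ! i) = 0" using independentD[OF assms(2), of "set bs" u] i by auto
  then show "c i = 0" using u[OF i] by simp
qed

lemma lin_indep_imp_distinct:
  assumes "lin_indep xs"
  shows "distinct xs"
  unfolding distinct_conv_nth
proof (intro allI impI notI)
  fix i j assume ij: "i < length xs" "j < length xs" "i \<noteq> j" "xs ! i = xs ! j"
  then have "lc (\<lambda>k. if k = i then 1 else 0) xs = lc (\<lambda>k. if k = j then 1 else 0) xs" by (simp add: lc_unit)
  from lc_eq_iff_coeffs[OF assms this ij(1)] ij(3) show False by simp
qed

lemma lin_indep_imp_independent:
  assumes "lin_indep xs"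
  shows "independent (set xs)"
proof
  assume "dependent (set xs)"
  then obtain u y where u: "y \<in> set xs" "u y \<noteq> 0" "(\<Sum>x\<in>set xs. u x *s x) = 0"
    using dependent_finite[of "set xs"] by auto
  have "lc (\<lambda>i. u (xs ! i)) xs = (\<Sum>x\<in>set xs. u x *s x)"
    unfolding lin_comb_def by (rule sum.reindex_bij_betw[OF bij_betw_nth[OF lin_indep_imp_distinct[OF assms] refl refl]])
  then have "\<forall>i<length xs. u (xs ! i) = 0" using assms u(3) unfolding lin_indep_def by metis
  then show False using u(1,2) by (metis in_set_conv_nth)
qed

lemma linear_lc:
  assumes "Vector_Spaces.linear scale scale T"
  shows "T (lc c xs) = lc c (map T xs)"
proof -
  interpret T: Vector_Spaces.linear scale scale T by fact
  show ?thesis by (simp add: lin_comb_def T.sum T.scale)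
qed

lemma coords_map: "Vector_Spaces.linear scale scale T \<Longrightarrow> coords xs ys M \<Longrightarrow> coords (map T xs) (map T ys) M"
  by (auto simp: coords_def linear_lc)

lemma ordered_basis_lin_indep: "ordered_basis scale S bs \<Longrightarrow> lin_indep bs"
  unfolding ordered_basis_def by (intro lin_indep_list) auto

lemma coords_matrix_wrt:
  assumes "ordered_basis scale S bs" "T ` S \<subseteq> S"
  shows "coords bs (map T bs) (matrix_wrt scale bs T)"
  unfolding coords_def
proof (intro conjI allI impI)
  show "matrix_wrt scale bs T \<in> carrier_mat (length bs) (length (map T bs))" by (simp add: matrix_wrt_def)
  fix j assume j: "j < length (map T bs)"
  have b: "distinct bs" "independent (set bs)" "span (set bs) = S" using assms by (auto simp: ordered_basis_def)
  have "bs ! j \<in> S" using j b(3) span_base[of "bs ! j" "set bs"] by auto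
  then have Tj: "T (bs ! j) \<in> span (set bs)" using assms(2) b(3) by auto
  have "lc (\<lambda>i. matrix_wrt scale bs T $$ (i, j)) bs = lc (\<lambda>i. representation (set bs) (T (bs ! j)) (bs ! i)) bs"
    using j by (intro lc_cong) (auto simp: matrix_wrt_def)
  also have "\<dots> = (\<Sum>b\<in>set bs. representation (set bs) (T (bs ! j)) b *s b)"
    unfolding lin_comb_def by (rule sum.reindex_bij_betw[OF bij_betw_nth[OF b(1) refl refl]])
  also have "\<dots> = T (bs ! j)" using b Tj by (intro sum_representation_eq) auto
  finally show "map T bs ! j = lc (\<lambda>i. matrix_wrt scale bs T $$ (i, j)) bs" using j by simp
qed

end

section \<open>Lattices and Hodge tuples\<close>

locale valued_space = coordinate_space scale + valued_field w
  for scale :: "'k::field \<Rightarrow> 'v::ab_group_add \<Rightarrow> 'v" (infixr "*s" 75) and w :: "'k \<Rightarrow> 'g::linordered_ab_group_add extended"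
begin

abbreviation int_ring :: "'k set" where "int_ring \<equiv> {x. 0 \<le> w x}"

text \<open>
  A linear relation over the field becomes a relation over the valuation ring after division by a
  coefficient of least valuation, and that coefficient becomes 1.
\<close>
lemma basis_over_lin_indep:
  assumes "basis_over scale int_ring es \<Lambda>"
  shows "lin_indep es"
proof (rule ccontr)
  assume "\<not> lin_indep es"
  then obtain c i where c: "lc c es = 0" "i < length es" "c i \<noteq> 0" by (auto simp: lin_indep_def)
  have "Min ((\<lambda>k. w (c k)) ` {..<length es}) \<in> (\<lambda>k. w (c k)) ` {..<length es}"
    using c by (intro Min_in) auto
  then obtain j where "j \<in> {..<length es}" and j2: "Min ((\<lambda>k. w (c k)) ` {..<length es}) = w (c j)" by (rule imageE)
  then have j: "j < length es" by simp
  have min: "w (c j) \<le> w (c k)" if "k < length es" for k unfolding j2[symmetric] using that by (intro Min_le) auto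
  have nz: "c j \<noteq> 0" using min[OF c(2)] c(3) by auto
  define d where "d = (\<lambda>k. inverse (c j) * c k)"
  have "lc d es = 0" unfolding d_def lc_scale c(1) by simp
  moreover have "\<forall>k<length es. d k \<in> int_ring"
    using v_divide_nonneg[OF nz min] by (simp add: d_def divide_inverse mult.commute)
  moreover have "(\<forall>k<length es. d k \<in> int_ring) \<and> lc d es = 0 \<longrightarrow> (\<forall>k<length es. d k = 0)"
    using assms unfolding basis_over_def by (rule conjunct2[THEN spec])
  ultimately have "\<forall>k<length es. d k = 0" by (elim mp) (rule conjI)
  then have "inverse (c j) * c j = 0" using j unfolding d_def by blast
  then show False using nz by simp
qed

lemma span_overI: "(\<And>i. i < length xs \<Longrightarrow> c i \<in> int_ring) \<Longrightarrow> lc c xs \<in> span_over scale int_ring xs"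
  unfolding span_over_def by blast

lemma span_overE:
  assumes "y \<in> span_over scale int_ring xs"
  obtains c where "y = lc c xs" "\<And>i. i < length xs \<Longrightarrow> 0 \<le> w (c i)"
  using assms unfolding span_over_def by blast

lemma nth_in_span_over: "k < length xs \<Longrightarrow> xs ! k \<in> span_over scale int_ring xs"
  using span_overI[of xs "\<lambda>i. if i = k then 1 else 0"] lc_unit[of k xs] by simp

lemma span_over_diff:
  assumes "x \<in> span_over scale int_ring xs" "y \<in> span_over scale int_ring xs"
  shows "x - y \<in> span_over scale int_ring xs"
proof -
  obtain c d where cd: "x = lc c xs" "\<And>i. i < length xs \<Longrightarrow> 0 \<le> w (c i)" "y = lc d xs" "\<And>i. i < length xs \<Longrightarrow> 0 \<le> w (d i)"
    using assms by (metis span_overE)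
  have "x - y = lc (\<lambda>i. c i - d i) xs" using cd by (simp add: lc_diff)
  moreover have "0 \<le> w (c i - d i)" if "i < length xs" for i
    using v_add_ge[of 0 "c i" "- d i"] cd that by simp
  ultimately show ?thesis using span_overI[of xs "\<lambda>i. c i - d i"] by simp
qed

lemma span_over_mono:
  assumes "coords xs ys M" "integral_mat M"
  shows "span_over scale int_ring ys \<subseteq> span_over scale int_ring xs"
proof
  fix y assume "y \<in> span_over scale int_ring ys"
  then obtain c where c: "y = lc c ys" "\<And>i. i < length ys \<Longrightarrow> 0 \<le> w (c i)" by (metis span_overE)
  have M: "M \<in> carrier_mat (length xs) (length ys)" using assms by (simp add: coords_def)
  have "0 \<le> w (\<Sum>j<length ys. M $$ (i, j) * c j)" if "i < length xs" for i
    using c integral_matD[OF assms(2) M that] by (intro v_sum_ge v_mult_nonneg) auto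
  then show "y \<in> span_over scale int_ring xs"
    unfolding c(1) coords_lc[OF assms(1)] by (intro span_overI) simp
qed

lemma integral_coords_exist:
  assumes "set ys \<subseteq> span_over scale int_ring xs"
  obtains M where "coords xs ys M" "integral_mat M"
proof -
  have "\<forall>j<length ys. \<exists>c. ys ! j = lc c xs \<and> (\<forall>i<length xs. 0 \<le> w (c i))"
    using assms unfolding span_over_def by (fastforce simp: set_conv_nth)
  then obtain c where c: "\<And>j. j < length ys \<Longrightarrow> ys ! j = lc (c j) xs \<and> (\<forall>i<length xs. 0 \<le> w (c j i))" by metis
  have "coords xs ys (mat (length xs) (length ys) (\<lambda>(i, j). c j i))"
    unfolding coords_def using c by (auto intro!: lc_cong)
  moreover have "integral_mat (mat (length xs) (length ys) (\<lambda>(i, j). c j i))"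
    using c by (auto simp: integral_mat_def)
  ultimately show ?thesis using that by blast
qed

lemma image_span_over:
  assumes "Vector_Spaces.linear scale scale T"
  shows "T ` span_over scale int_ring xs = span_over scale int_ring (map T xs)"
  unfolding span_over_def setcompr_eq_image image_image linear_lc[OF assms] by simp

definition power_diag :: "'k \<Rightarrow> int extended list \<Rightarrow> 'k mat" where
  "power_diag p ms = mat (length ms) (length ms) (\<lambda>(i, j). if i = j then extended_power p (ms ! i) else 0)"

lemma coords_power_diag:
  assumes "length ms = length es"
  shows "coords es (map2 (\<lambda>m e. scale (extended_power p m) e) ms es) (power_diag p ms)"
  unfolding coords_def
proof (intro conjI allI impI)
  fix j assume "j < length (map2 (\<lambda>m e. scale (extended_power p m) e) ms es)"
  then have j: "j < length es" "j < length ms" using assms by auto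
  have "lc (\<lambda>i. power_diag p ms $$ (i, j)) es = lc (\<lambda>i. extended_power p (ms ! j) * (if i = j then 1 else 0)) es"
    using j assms by (intro lc_cong) (auto simp: power_diag_def)
  also have "\<dots> = extended_power p (ms ! j) *s es ! j" by (simp only: lc_scale lc_unit[OF j(1)])
  finally show "map2 (\<lambda>m e. scale (extended_power p m) e) ms es ! j = lc (\<lambda>i. power_diag p ms $$ (i, j)) es"
    using j by simp
qed (use assms in \<open>simp add: power_diag_def\<close>)

text \<open>
  The equality of the two modules \<open>T \<Lambda>\<close> and \<open>\<Sum> \<oo> \<pi>\<^sup>\<mu> e\<close> in the definition of a Hodge tuple gives two integral
  matrices \<open>R\<close> and \<open>R'\<close>, one for each inclusion.  They need not be inverse to each other
  when \<open>T\<close> is singular, but the two factorizations suffice to compare minors.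
\<close>
lemma hodge_tuple_factorization:
  assumes ms: "is_hodge_tuple scale int_ring p T \<Lambda> ms"
    and T: "Vector_Spaces.linear scale scale T"
    and es: "basis_over scale int_ring es \<Lambda>" "length es = n" "n = dim UNIV"
    and A: "coords es (map T es) A"
  obtains L R L' R' where "length ms = n" "L \<in> carrier_mat n n" "R \<in> carrier_mat n n" "L' \<in> carrier_mat n n" "R' \<in> carrier_mat n n"
    "integral_mat L" "integral_mat R" "integral_mat L'" "integral_mat R'"
    "A = L * power_diag p ms * R" "power_diag p ms = L' * A * R'"
proof -
  obtain fs where fs: "length fs = n" "length ms = n" "basis_over scale int_ring fs \<Lambda>"
    and T\<Lambda>: "T ` \<Lambda> = span_over scale int_ring (map2 (\<lambda>m e. scale (extended_power p m) e) ms fs)"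
    using ms es(3) unfolding is_hodge_tuple_def by auto
  define ds where "ds = map2 (\<lambda>m e. scale (extended_power p m) e) ms fs"
  have len: "length ds = n" using fs by (simp add: ds_def)
  have D: "coords fs ds (power_diag p ms)" unfolding ds_def using fs by (intro coords_power_diag) simp
  have \<Lambda>es: "\<Lambda> = span_over scale int_ring es" and \<Lambda>fs: "\<Lambda> = span_over scale int_ring fs"
    using es fs by (auto simp: basis_over_def)
  have T\<Lambda>es: "T ` \<Lambda> = span_over scale int_ring (map T es)" unfolding \<Lambda>es by (rule image_span_over[OF T])
  have "set fs \<subseteq> span_over scale int_ring es"
    using nth_in_span_over[of _ fs] unfolding \<Lambda>es[symmetric] \<Lambda>fs by (auto simp: set_conv_nth)
  then obtain L where L: "coords es fs L" "integral_mat L" by (rule integral_coords_exist)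
  have "set es \<subseteq> span_over scale int_ring fs"
    using nth_in_span_over[of _ es] unfolding \<Lambda>fs[symmetric] \<Lambda>es by (auto simp: set_conv_nth)
  then obtain L' where L': "coords fs es L'" "integral_mat L'" by (rule integral_coords_exist)
  have "set (map T es) \<subseteq> span_over scale int_ring ds"
    using nth_in_span_over[of _ "map T es"] unfolding ds_def T\<Lambda>[symmetric] T\<Lambda>es by (force simp: set_conv_nth)
  then obtain R where R: "coords ds (map T es) R" "integral_mat R" by (rule integral_coords_exist)
  have "set ds \<subseteq> span_over scale int_ring (map T es)"
    using nth_in_span_over[of _ ds] unfolding T\<Lambda>es[symmetric] T\<Lambda> ds_def by (force simp: set_conv_nth)
  then obtain R' where R': "coords (map T es) ds R'" "integral_mat R'" by (rule integral_coords_exist)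
  have "A = L * power_diag p ms * R"
    by (rule coords_unique[OF basis_over_lin_indep[OF es(1)] A coords_trans[OF coords_trans[OF L(1) D] R(1)]])
  moreover have "power_diag p ms = L' * A * R'"
    by (rule coords_unique[OF basis_over_lin_indep[OF fs(3)] D coords_trans[OF coords_trans[OF L'(1) A] R'(1)]])
  ultimately show ?thesis
    using L L' R R' fs es len by (intro that[of L R L' R']) (auto simp: coords_def)
qed

text \<open>
  The Smith normal form of \<open>A\<close> provides the basis: its diagonal entries are units times powers of the
  uniformizer, and the units are absorbed into the right-hand factor.
\<close>
lemma hodge_tuple_exists:
  assumes T: "Vector_Spaces.linear scale scale T"
    and es: "basis_over scale int_ring es \<Lambda>" "length es = n" "n = dim UNIV"
    and A: "coords es (map T es) A"
    and powers: "\<And>x. \<exists>m u. m \<noteq> Minf \<and> w u = 0 \<and> x = u * extended_power p m"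
    and mono: "\<And>m m'. m \<noteq> Minf \<Longrightarrow> m' \<noteq> Minf \<Longrightarrow> w (extended_power p m) \<le> w (extended_power p m') \<Longrightarrow> m \<le> m'"
  shows "\<exists>ms. is_hodge_tuple scale int_ring p T \<Lambda> ms"
proof -
  have Ac: "A \<in> carrier_mat n n" using A es by (simp add: coords_def)
  obtain P P' Q Q' where PP: "integral_inverses n P P'" and QQ: "integral_inverses n Q Q'"
    and dg: "diagonal_mat (P * A * Q)"
    and srt: "\<And>i j. i \<le> j \<Longrightarrow> j < n \<Longrightarrow> w ((P * A * Q) $$ (i, i)) \<le> w ((P * A * Q) $$ (j, j))"
    using Smith_decomposition[OF Ac] by metis
  define E where "E = P * A * Q"
  have Pc: "P \<in> carrier_mat n n" "P' \<in> carrier_mat n n" "P * P' = 1\<^sub>m n" "P' * P = 1\<^sub>m n" "integral_mat P" "integral_mat P'"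
    and Qc: "Q \<in> carrier_mat n n" "Q' \<in> carrier_mat n n" "Q * Q' = 1\<^sub>m n" "Q' * Q = 1\<^sub>m n" "integral_mat Q" "integral_mat Q'"
    using PP QQ by (auto simp: integral_inverses_def)
  have E: "E \<in> carrier_mat n n" using Pc Qc Ac by (simp add: E_def)
  have "\<forall>k. \<exists>m u. m \<noteq> Minf \<and> w u = 0 \<and> E $$ (k, k) = u * extended_power p m" using powers by blast
  then obtain m u where mu: "\<And>k. m k \<noteq> Minf" "\<And>k. w (u k) = 0" "\<And>k. E $$ (k, k) = u k * extended_power p (m k)" by metis
  define ms where "ms = map m [0..<n]"
  have ms: "length ms = n" "ms ! k = m k" if "k < n" for k using that by (auto simp: ms_def)
  have len_ms: "length ms = n" by (simp add: ms_def)
  have ms_sorted: "sorted ms"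
    unfolding sorted_iff_nth_mono
  proof (intro allI impI)
    fix i j assume ij: "i \<le> j" "j < length ms"
    have "w (extended_power p (m k)) = w (E $$ (k, k))" for k using mu(2,3)[of k] by (simp add: v_mult)
    then have "w (extended_power p (m i)) \<le> w (extended_power p (m j))"
      using srt[OF ij(1)] ij len_ms by (simp add: E_def)
    then show "ms ! i \<le> ms ! j" using mono mu(1) ij len_ms by (simp add: ms_def)
  qed
  have ms_Minf: "Minf \<notin> set ms" using mu(1) unfolding ms_def by (metis imageE list.set_map)
  define D where "D = power_diag p ms"
  have D: "D \<in> carrier_mat n n" by (simp add: D_def power_diag_def len_ms)
  define U where "U = mat n n (\<lambda>(i, j). if i = j then u i else 0)"
  define U' where "U' = mat n n (\<lambda>(i, j). if i = j then inverse (u i) else 0)"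
  have U: "U \<in> carrier_mat n n" "U' \<in> carrier_mat n n" by (auto simp: U_def U'_def)
  have intU: "integral_mat U" "integral_mat U'"
    using mu(2) v_inverse_nonneg[OF mu(2)] by (auto simp: integral_mat_def U_def U'_def)
  have u0: "u k \<noteq> 0" for k using mu(2)[of k] by (auto simp: zero_extended_def)
  have EU: "E = D * U"
  proof (rule eq_matI)
    fix i j assume "i < dim_row (D * U)" "j < dim_col (D * U)"
    then have ij: "i < n" "j < n" using D U by auto
    have "(D * U) $$ (i, j) = (\<Sum>k<n. if k = i then (if i = j then E $$ (i, i) else 0) else 0)"
      unfolding mat_mult_entry[OF D U(1) ij] using ij mu(3)[of i]
      by (intro sum.cong) (auto simp: D_def power_diag_def ms U_def mult.commute)
    also have "\<dots> = E $$ (i, j)" using ij dg E by (auto simp: diagonal_mat_def E_def[symmetric])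
    finally show "E $$ (i, j) = (D * U) $$ (i, j)" by simp
  qed (use D U E in auto)
  have UU: "U * U' = 1\<^sub>m n"
  proof (rule eq_matI)
    fix i j assume "i < dim_row (1\<^sub>m n)" "j < dim_col (1\<^sub>m n)"
    then have ij: "i < n" "j < n" by auto
    have "(U * U') $$ (i, j) = (\<Sum>k<n. if k = i then (if i = j then 1 else 0) else 0)"
      unfolding mat_mult_entry[OF U ij] using ij u0[of i] by (intro sum.cong) (auto simp: U_def U'_def)
    then show "(U * U') $$ (i, j) = 1\<^sub>m n $$ (i, j)" using ij by simp
  qed (use U in auto)
  note assoc = assoc_mult_mat[of _ n n _ n _ n]
  have A_eq: "A = (P' * D) * (U * Q')"
  proof -
    have PP1: "P' * (P * Z) = Z" if "Z \<in> carrier_mat n n" for Z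
      using assoc[OF Pc(2,1) that] Pc that by simp
    have "A = P' * (P * A * Q) * Q'" using Pc Qc Ac by (simp add: assoc PP1)
    then show ?thesis using Pc(2) D U(1) Qc(2) unfolding E_def[symmetric] EU by (simp add: assoc)
  qed
  have AQU: "P' * D = A * (Q * U')"
  proof -
    have QQ1: "Q' * (Q * Z) = Z" if "Z \<in> carrier_mat n n" for Z
      using assoc[OF Qc(2,1) that] Qc that by simp
    show ?thesis unfolding A_eq using Pc Qc D U UU by (simp add: assoc QQ1)
  qed
  define fs where "fs = map (\<lambda>j. lc (\<lambda>i. P' $$ (i, j)) es) [0..<n]"
  have fs: "coords es fs P'" "length fs = n" using Pc es by (auto simp: coords_def fs_def)
  have fs': "coords fs es P"
    using coords_cancel[OF fs(1), of P es] coords_self[of es] Pc es fs by simp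
  have "lin_indep fs"
    using Pc fs es by (intro lin_indep_coords[OF basis_over_lin_indep[OF es(1)] fs(1)]) auto
  then have fs_basis: "basis_over scale int_ring fs \<Lambda>"
    using span_over_mono[OF fs(1) Pc(6)] span_over_mono[OF fs' Pc(5)] es(1)
    unfolding basis_over_def lin_indep_def by auto
  define ds where "ds = map2 (\<lambda>m e. scale (extended_power p m) e) ms fs"
  have len: "length ds = n" using fs len_ms by (simp add: ds_def)
  have "coords fs ds D" unfolding ds_def D_def using fs len_ms by (intro coords_power_diag) simp
  then have esds: "coords es ds (P' * D)" by (rule coords_trans[OF fs(1)])
  have "coords ds (map T es) (U * Q')"
    by (rule coords_cancel[OF esds]) (use A A_eq U Qc len es in auto)
  moreover have "coords (map T es) ds (Q * U')"
    by (rule coords_cancel[OF A]) (use esds AQU U Qc len es in auto)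
  ultimately have "span_over scale int_ring (map T es) = span_over scale int_ring ds"
    using span_over_mono[of ds "map T es" "U * Q'"] span_over_mono[of "map T es" ds "Q * U'"]
      integral_mat_mult[OF U(1) Qc(2) intU(1) Qc(6)] integral_mat_mult[OF Qc(1) U(2) Qc(5) intU(2)] by blast
  moreover have "T ` \<Lambda> = span_over scale int_ring (map T es)"
    using es(1) image_span_over[OF T, of es] by (simp add: basis_over_def)
  ultimately have "T ` \<Lambda> = span_over scale int_ring (map2 (\<lambda>m e. scale (extended_power p m) e) ms fs)"
    by (simp add: ds_def)
  then show ?thesis
    unfolding is_hodge_tuple_def using ms_sorted ms_Minf fs_basis fs len_ms es(3) by metis
qed

end

text \<open>
  Up to the first infinite entry the partial sums are finite and can be cancelled; from there on both
  lists consist of \<open>Pinf\<close>.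
\<close>
lemma sorted_extended_eqI:
  fixes xs ys :: "'g::linordered_ab_group_add extended list"
  assumes "length xs = length ys" "sorted xs" "sorted ys" "Minf \<notin> set xs" "Minf \<notin> set ys"
    and sums: "\<And>i. i \<le> length xs \<Longrightarrow> (\<Sum>k<i. xs ! k) = (\<Sum>k<i. ys ! k)"
  shows "xs = ys"
proof (rule nth_equalityI[OF assms(1)])
  fix k assume "k < length xs"
  then show "xs ! k = ys ! k"
  proof (induction k rule: less_induct)
    case (less k)
    have nm: "xs ! j \<noteq> Minf" "ys ! j \<noteq> Minf" if "j \<le> k" for j
      using that less assms by (metis le_less_trans nth_mem)+
    show ?case
    proof (cases "\<exists>j<k. xs ! j = Pinf")
      case True
      then obtain j where j: "j < k" "xs ! j = Pinf" by auto
      then have "ys ! j = Pinf" using less by auto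
      then show ?thesis using j sorted_nth_mono[OF assms(2), of j k] sorted_nth_mono[OF assms(3), of j k] less assms(1) by auto
    next
      case False
      have "\<exists>a. (\<Sum>j<l. xs ! j) = Fin a" if "l \<le> k" for l
        using that
      proof (induction l)
        case 0 then show ?case by (simp add: zero_extended_def)
      next
        case (Suc l)
        then obtain a where "(\<Sum>j<l. xs ! j) = Fin a" by auto
        moreover obtain b where "xs ! l = Fin b" using Suc False nm(1)[of l] by (cases "xs ! l") auto
        ultimately show ?case by simp
      qed
      then obtain a where a: "(\<Sum>j<k. xs ! j) = Fin a" by auto
      have "Fin a + xs ! k = Fin a + ys ! k"
        using sums[of "Suc k"] sums[of k] less a by simp
      then show ?thesis using nm[of k] by (cases "xs ! k"; cases "ys ! k") auto
    qed
  qed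
qed

section \<open>The valuation and the algebraic closure\<close>

interpretation to_ac: field_hom "to_ac :: 'a::field \<Rightarrow> 'a alg_closure"
  by unfold_locales auto

lemma valuation_to_ac: "valuation val \<Longrightarrow> valuation (\<lambda>x. val (to_ac x))"
  by (auto simp: valuation_def)

lemma valuation_extended_power:
  fixes v :: "'k::field \<Rightarrow> 'g::linordered_idom extended"
  assumes "valuation v" "v p = 1" "m \<noteq> Minf"
  shows "v (extended_power p m) = map_extended of_int m"
proof -
  interpret valued_field v by unfold_locales fact
  have pow: "v (x ^ k) = Fin (of_nat k * a)" if "v x = Fin a" for x a k
    using that by (induction k) (auto simp: v_mult zero_extended_def algebra_simps)
  have p: "v p = Fin 1" using assms(2) by (simp add: one_extended_def)
  then have p0: "p \<noteq> 0" by auto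
  obtain b where b: "v (inverse p) = Fin b" using v_Fin[of "inverse p"] p0 by auto
  have "v p + v (inverse p) = 0" using p0 v_mult[of p "inverse p"] by simp
  then have "1 + b = 0" unfolding p b by (simp add: zero_extended_def)
  then have "v (inverse p) = Fin (- 1)" using b by (simp add: eq_neg_iff_add_eq_0 add.commute)
  note inv = pow[OF this]
  show ?thesis
  proof (cases m)
    case (Fin k)
    then show ?thesis using pow[OF p, of "nat k"] inv[of "nat (- k)"]
      by (auto simp: extended_power_def power_int_def)
  qed (use assms in \<open>auto simp: extended_power_def\<close>)
qed

lemma map_extended_of_int_le_iff:
  "map_extended (of_int :: int \<Rightarrow> 'g::linordered_idom) m \<le> map_extended of_int m' \<longleftrightarrow> m \<le> m'"
  by (cases m; cases m') auto

text \<open>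
  The valuation ring alone determines the units, hence the integer exponent: \<open>p\<close> has value 1 under the discrete valuation
  \<open>v0\<close> that defines the ring, because some element of value 1 is a non-unit and therefore a multiple of
  \<open>p\<close>.  The quotient of \<open>x\<close> by the power of \<open>p\<close> with the same value under \<open>v0\<close> is a unit of the ring, so
  its valuation \<open>w\<close> is 0 too.
\<close>
lemma uniformizer_powers:
  fixes w :: "'k::field \<Rightarrow> 'g::linordered_ab_group_add extended"
  assumes w: "valuation w" and dvr: "is_dvr {x. 0 \<le> w x}" and unif: "is_uniformizer {x. 0 \<le> w x} p"
  shows "\<exists>m u. m \<noteq> Minf \<and> w u = 0 \<and> x = u * extended_power p m"
proof (cases "x = 0")
  case True
  interpret valued_field w by unfold_locales fact
  show ?thesis using True by (intro exI[of _ Pinf] exI[of _ 1]) (auto simp: extended_power_def)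
next
  case False
  interpret valued_field w by unfold_locales fact
  obtain v0 :: "'k \<Rightarrow> int extended" where v0: "discrete_valuation v0" and ring: "{x. 0 \<le> w x} = {x. 0 \<le> v0 x}"
    using dvr unfolding is_dvr_def by auto
  interpret v0: valued_field v0 using v0 by unfold_locales (simp add: discrete_valuation_def)
  have ring_iff: "0 \<le> w x \<longleftrightarrow> 0 \<le> v0 x" for x using ring by auto
  have unit_v0: "v0 a = 0" if "0 \<le> v0 a" "0 \<le> v0 b" "a * b = 1" for a b
  proof -
    have "v0 a + v0 b = 0" using that(3) v0.v_mult[of a b] by simp
    then show ?thesis using that by (cases "v0 a"; cases "v0 b") (auto simp: zero_extended_def)
  qed
  have v0_unit: "\<exists>b. 0 \<le> v0 b \<and> a * b = 1" if "v0 a = 0" for a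
  proof (intro exI[of _ "inverse a"] conjI)
    have "a \<noteq> 0" using that by (auto simp: zero_extended_def)
    then show "a * inverse a = 1" by simp
  qed (simp add: v0.v_inverse_nonneg[OF that])
  have nonunits: "{x \<in> {x. 0 \<le> v0 x}. \<not> (\<exists>y\<in>{x. 0 \<le> v0 x}. x * y = 1)} = (\<lambda>x. p * x) ` {x. 0 \<le> v0 x}"
    and p: "0 \<le> v0 p" using unif unfolding is_uniformizer_def ring by auto
  have "p = p * 1" "0 \<le> v0 1" by simp_all
  then have "p \<in> (\<lambda>x. p * x) ` {x. 0 \<le> v0 x}" by blast
  then have "\<not> (\<exists>y\<in>{x. 0 \<le> v0 x}. p * y = 1)" unfolding nonunits[symmetric] by simp
  then have "v0 p \<noteq> 0" using v0_unit[of p] by auto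
  obtain t where t: "v0 t = Fin 1" using v0 unfolding discrete_valuation_def by (metis imageE rangeI)
  have "\<not> (\<exists>y\<in>{x. 0 \<le> v0 x}. t * y = 1)" using unit_v0[of t] t by (auto simp: zero_extended_def)
  then have "t \<in> (\<lambda>x. p * x) ` {x. 0 \<le> v0 x}" unfolding nonunits[symmetric] using t by (simp add: zero_extended_def)
  then obtain y where y: "t = p * y" "0 \<le> v0 y" by auto
  have "v0 p + v0 y = Fin 1" using t y v0.v_mult[of p y] by simp
  then have p1: "v0 p = 1"
    using y(2) p \<open>v0 p \<noteq> 0\<close> by (cases "v0 p"; cases "v0 y") (auto simp: zero_extended_def one_extended_def)
  obtain k where k: "v0 x = Fin k" using v0.v_Fin[OF False] by auto
  define q where "q = extended_power p (Fin k)"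
  have "v0 q = map_extended of_int (Fin k)"
    unfolding q_def by (rule valuation_extended_power[OF v0.valuation p1]) simp
  then have vq: "v0 q = Fin k" by simp
  then have q0: "q \<noteq> 0" by auto
  have "0 \<le> v0 (x / q)" "0 \<le> v0 (q / x)" using vq k q0 False by (auto intro!: v0.v_divide_nonneg)
  then have nn: "0 \<le> w (x / q)" "0 \<le> w (q / x)" by (simp_all add: ring_iff)
  have "w (x / q) + w (q / x) = 0" using v_mult[of "x / q" "q / x"] False q0 by simp
  then have "w (x / q) = 0" using nn by (cases "w (x / q)"; cases "w (q / x)") (auto simp: zero_extended_def add_nonneg_eq_0_iff)
  then show ?thesis using q0 by (intro exI[of _ "Fin k"] exI[of _ "x / q"]) (auto simp: q_def)
qed

lemma proots_linear_factors:
  fixes as :: "'a::field list"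
  shows "proots (\<Prod>a\<leftarrow>as. [:- a, 1:]) = mset as"
proof (induction as)
  case (Cons a as)
  have "(\<Prod>a\<leftarrow>as. [:- a, 1:]) \<noteq> 0" by (auto simp: prod_list_zero_iff)
  then have "proots ([:- a, 1:] * (\<Prod>a\<leftarrow>as. [:- a, 1:])) = proots [:- a, 1:] + mset as"
    unfolding Cons.IH[symmetric] by (intro proots_mult) auto
  then show ?case unfolding list.map prod_list.Cons by simp
qed simp

lemma char_poly_to_ac_splits:
  fixes M :: "'a::field mat"
  assumes M: "M \<in> carrier_mat n n" and as: "mset as = proots (map_poly to_ac (char_poly M))"
  shows "char_poly (map_mat to_ac M) = (\<Prod>a\<leftarrow>as. [:- a, 1:])"
proof -
  let ?q = "char_poly (map_mat to_ac M)"
  have MK: "map_mat to_ac M \<in> carrier_mat n n" using M by simp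
  have q: "?q = map_poly to_ac (char_poly M)" by (rule to_ac.char_poly_hom[OF M])
  have lead: "lead_coeff ?q = 1" using degree_monic_char_poly[OF MK] by simp
  then have "?q \<noteq> 0" by auto
  from alg_closed_imp_factorization[OF this] obtain B where B: "?q = (\<Prod>x\<in>#B. [:-x, 1:])"
    using lead by auto
  obtain bs where bs: "mset bs = B" using ex_mset by blast
  have qbs: "?q = (\<Prod>a\<leftarrow>bs. [:- a, 1:])" unfolding B
    by (simp only: bs[symmetric] mset_map[symmetric] prod_mset_prod_list)
  then have "mset bs = mset as" using as q proots_linear_factors[of bs] by simp
  then have "mset (map (\<lambda>a. [:- a, 1:]) bs) = mset (map (\<lambda>a. [:- a, 1:]) as)" by simp
  then show ?thesis unfolding qbs by (simp only: prod_mset_prod_list[symmetric])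
qed

lemma sorted_list_of_multiset_union_less:
  assumes "\<And>a b. a \<in># M \<Longrightarrow> b \<in># N \<Longrightarrow> a < b"
  shows "sorted_list_of_multiset (M + N) = sorted_list_of_multiset M @ sorted_list_of_multiset N"
proof -
  have "sorted_list_of_multiset (mset (sorted_list_of_multiset M @ sorted_list_of_multiset N)) = sorted_list_of_multiset M @ sorted_list_of_multiset N"
    using assms by (subst sorted_list_of_multiset_mset) (fastforce intro!: sort_key_id_if_sorted simp: sorted_append)
  then show ?thesis by simp
qed

section \<open>Newton point and Hodge point\<close>

locale hodge_newton_setting =
  valued_space scale "\<lambda>x. val (to_ac x)" + finite_dimensional_vector_space scale Basis
  for scale :: "'f::field \<Rightarrow> 'v::ab_group_add \<Rightarrow> 'v" (infixr "*s" 75)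
    and val :: "'f alg_closure \<Rightarrow> rat extended" and Basis :: "'v set" +
  fixes \<pi> :: 'f and T :: "'v \<Rightarrow> 'v" and \<Lambda> :: "'v set" and es :: "'v list" and A :: "'f mat" and n :: nat
  assumes val: "valuation val" and val_\<pi>: "val (to_ac \<pi>) = 1"
    and dvr: "is_dvr int_ring" and unif: "is_uniformizer int_ring \<pi>"
    and T: "Vector_Spaces.linear scale scale T"
    and n_def: "n = dim UNIV"
    and es: "basis_over scale int_ring es \<Lambda>" and len_es: "length es = n" and span_es: "span (set es) = UNIV"
    and A: "coords es (map T es) A"
begin

sublocale K: valued_field val
  by unfold_locales (rule val)

abbreviation toK :: "'f mat \<Rightarrow> 'f alg_closure mat" where "toK \<equiv> map_mat to_ac"

lemma integral_toK [simp]: "K.integral_mat (toK M) \<longleftrightarrow> integral_mat M"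
  by (auto simp: K.integral_mat_def integral_mat_def)

lemma A_carrier: "A \<in> carrier_mat n n"
  using A len_es by (simp add: coords_def)

lemma \<Lambda>_eq: "\<Lambda> = span_over scale int_ring es"
  using es by (simp add: basis_over_def)

lemma toK_mult3:
  "P \<in> carrier_mat n n \<Longrightarrow> M \<in> carrier_mat n n \<Longrightarrow> Q \<in> carrier_mat n n \<Longrightarrow> toK (P * M * Q) = toK P * toK M * toK Q"
  by (simp add: to_ac.mat_hom_mult[of _ n n _ n])

lemma val_power: "m \<noteq> Minf \<Longrightarrow> val (to_ac (extended_power \<pi> m)) = map_extended of_int m"
  by (rule valuation_extended_power[OF valuation val_\<pi>])

text \<open>
  \<open>A\<close> and the diagonal matrix of the Hodge tuple divide each other integrally on both sides, so they have
  the same bounds on their minors; for the diagonal matrix the optimal bound is the sum of its first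
  \<open>i\<close> valuations.
\<close>
lemma hodge_minors:
  assumes ms: "is_hodge_tuple scale int_ring \<pi> T \<Lambda> ms" and i: "i \<le> n"
  shows "K.minors_ge i c (toK A) \<longleftrightarrow> c \<le> (\<Sum>k<i. map_extended of_int (ms ! k))"
proof -
  obtain L R L' R' where len: "length ms = n" and carr: "L \<in> carrier_mat n n" "R \<in> carrier_mat n n" "L' \<in> carrier_mat n n" "R' \<in> carrier_mat n n"
    and int: "integral_mat L" "integral_mat R" "integral_mat L'" "integral_mat R'"
    and eq: "A = L * power_diag \<pi> ms * R" "power_diag \<pi> ms = L' * A * R'"
    by (rule hodge_tuple_factorization[OF ms T es len_es n_def A])
  define D where "D = toK (power_diag \<pi> ms)"
  have Dc: "power_diag \<pi> ms \<in> carrier_mat n n" by (simp add: power_diag_def len)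
  have D: "D \<in> carrier_mat n n" by (simp add: D_def power_diag_def len)
  have dg: "diagonal_mat D" and ut: "upper_triangular D" by (auto simp: diagonal_mat_def D_def power_diag_def)
  have nm: "ms ! k \<noteq> Minf" if "k < n" for k
    using ms that len unfolding is_hodge_tuple_def by (metis nth_mem)
  have Dk: "val (D $$ (k, k)) = map_extended of_int (ms ! k)" if "k < n" for k
    using that len val_power[OF nm[OF that]] by (simp add: D_def power_diag_def)
  have sum: "(\<Sum>k<i. val (D $$ (k, k))) = (\<Sum>k<i. map_extended of_int (ms ! k))"
    using Dk i by (intro sum.cong) auto
  have AD: "toK A = toK L * D * toK R" "D = toK L' * toK A * toK R'"
    unfolding D_def using toK_mult3 carr Dc A_carrier eq by metis+
  have "K.minors_ge i (\<Sum>k<i. val (D $$ (k, k))) D"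
  proof (rule K.minors_ge_diagonal[OF D dg i])
    fix k l assume kl: "k \<le> l" "l < n"
    then have "ms ! k \<le> ms ! l" using ms len unfolding is_hodge_tuple_def by (simp add: sorted_nth_mono)
    then show "val (D $$ (k, k)) \<le> val (D $$ (l, l))" using kl Dk by (simp add: map_extended_of_int_le_iff)
  qed
  then have A_minors: "K.minors_ge i (\<Sum>k<i. map_extended of_int (ms ! k)) (toK A)"
    unfolding sum AD(1) using D carr int by (intro K.minors_ge_mult) auto
  show ?thesis
  proof
    assume "K.minors_ge i c (toK A)"
    then have "K.minors_ge i c D"
      unfolding AD(2) using A_carrier carr int by (intro K.minors_ge_mult) auto
    then show "c \<le> (\<Sum>k<i. map_extended of_int (ms ! k))"
      using K.minors_ge_upper_triangularD[OF _ D ut i] sum by simp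
  next
    assume "c \<le> (\<Sum>k<i. map_extended of_int (ms ! k))"
    then show "K.minors_ge i c (toK A)" using A_minors unfolding K.minors_ge_def by (meson order_trans)
  qed
qed

lemma hodge_tuple_length: "is_hodge_tuple scale int_ring \<pi> T \<Lambda> ms \<Longrightarrow> length ms = n"
  unfolding is_hodge_tuple_def using n_def by auto

lemma hodge_tuple_unique:
  assumes "is_hodge_tuple scale int_ring \<pi> T \<Lambda> ms" "is_hodge_tuple scale int_ring \<pi> T \<Lambda> ms'"
  shows "ms = ms'"
proof -
  let ?f = "map_extended of_int :: int extended \<Rightarrow> rat extended"
  have len: "length ms = n" "length ms' = n" using assms hodge_tuple_length by auto
  have sums: "(\<Sum>k<i. ?f (ms ! k)) = (\<Sum>k<i. ?f (ms' ! k))" if "i \<le> n" for i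
    using hodge_minors[OF assms(1) that] hodge_minors[OF assms(2) that] by (metis antisym order_refl)
  have f_Minf: "?f m = Minf \<longleftrightarrow> m = Minf" for m by (cases m) auto
  have props: "sorted (map ?f xs) \<and> Minf \<notin> set (map ?f xs)"
    if "is_hodge_tuple scale int_ring \<pi> T \<Lambda> xs" for xs
  proof
    have xs: "sorted xs" "Minf \<notin> set xs" using that by (simp_all add: is_hodge_tuple_def)
    show "sorted (map ?f xs)"
      using xs(1) by (simp add: sorted_iff_nth_mono map_extended_of_int_le_iff)
    show "Minf \<notin> set (map ?f xs)"
    proof
      assume "Minf \<in> set (map ?f xs)"
      then obtain m where "m \<in> set xs" "?f m = Minf" by (metis image_iff list.set_map)
      then show False using f_Minf xs(2) by simp
    qed
  qed
  have "map ?f ms = map ?f ms'"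
  proof (rule sorted_extended_eqI)
    fix i assume "i \<le> length (map ?f ms)"
    then have i: "i \<le> n" using len by simp
    have "(\<Sum>k<i. map ?f ms ! k) = (\<Sum>k<i. ?f (ms ! k))" "(\<Sum>k<i. map ?f ms' ! k) = (\<Sum>k<i. ?f (ms' ! k))"
      using i len by (auto intro!: sum.cong nth_map)
    then show "(\<Sum>k<i. map ?f ms ! k) = (\<Sum>k<i. map ?f ms' ! k)" using sums[OF i] by (simp only:)
  next
    show "length (map ?f ms) = length (map ?f ms')" using len by simp
  qed (use props[OF assms(1)] props[OF assms(2)] in blast)+
  moreover have "inj ?f" by (rule injI) (metis map_extended_of_int_le_iff antisym order_refl)
  ultimately show ?thesis using inj_mapI[of ?f] by (simp add: inj_eq)
qed

lemma hodge_point_eq: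
  obtains ms where "is_hodge_tuple scale int_ring \<pi> T \<Lambda> ms" "hodge_point scale int_ring \<pi> T \<Lambda> = map (map_extended of_int) ms"
proof -
  have "\<exists>ms. is_hodge_tuple scale int_ring \<pi> T \<Lambda> ms"
  proof (rule hodge_tuple_exists[OF T es len_es n_def A])
    show "\<exists>m u. m \<noteq> Minf \<and> val (to_ac u) = 0 \<and> x = u * extended_power \<pi> m" for x
      using uniformizer_powers[OF valuation dvr unif] .
    show "m \<le> m'" if "m \<noteq> Minf" "m' \<noteq> Minf" "val (to_ac (extended_power \<pi> m)) \<le> val (to_ac (extended_power \<pi> m'))" for m m'
      using that by (simp add: val_power map_extended_of_int_le_iff)
  qed
  then obtain ms where ms: "is_hodge_tuple scale int_ring \<pi> T \<Lambda> ms" by blast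
  have "(THE ms. is_hodge_tuple scale int_ring \<pi> T \<Lambda> ms) = ms"
    using ms hodge_tuple_unique by blast
  then show ?thesis using that[OF ms] by (simp add: hodge_point_def)
qed

lemma hodge_point_minors:
  assumes "\<mu> = hodge_point scale int_ring \<pi> T \<Lambda>"
  shows "length \<mu> = n" "i \<le> n \<Longrightarrow> K.minors_ge i c (toK A) \<longleftrightarrow> c \<le> sum_list (take i \<mu>)"
proof -
  obtain ms where ms: "is_hodge_tuple scale int_ring \<pi> T \<Lambda> ms" "\<mu> = map (map_extended of_int) ms"
    using hodge_point_eq assms by metis
  show len: "length \<mu> = n" using ms hodge_tuple_length by simp
  assume i: "i \<le> n"
  have "sum_list (take i \<mu>) = (\<Sum>k<i. map_extended of_int (ms ! k))"
    using i len ms(2) by (simp add: sum_list_sum_nth atLeast0LessThan)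
  then show "K.minors_ge i c (toK A) \<longleftrightarrow> c \<le> sum_list (take i \<mu>)" using hodge_minors[OF ms(1) i] by simp
qed

lemma ordered_basis_exists:
  assumes "subspace S"
  shows "\<exists>bs. ordered_basis scale S bs"
proof -
  obtain B where B: "B \<subseteq> S" "independent B" "S \<subseteq> span B" using basis_exists[of S] by metis
  have "finite B" by (rule finiteI_independent[OF B(2)])
  then obtain bs where bs: "set bs = B" "distinct bs" using finite_distinct_list by auto
  have "span B = S" using B assms by (metis span_minimal subset_antisym)
  then show ?thesis using bs B unfolding ordered_basis_def by blast
qed

lemma slopes_on_eq:
  assumes "subspace S"
  obtains bs where "ordered_basis scale S bs" "length bs = dim S"
    "slopes_on scale val T S = image_mset val (proots (map_poly to_ac (char_poly (matrix_wrt scale bs T))))"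
proof -
  define bs where "bs = (SOME bs. ordered_basis scale S bs)"
  have b: "ordered_basis scale S bs"
    unfolding bs_def by (rule someI_ex[OF ordered_basis_exists[OF assms]])
  then have "dim S = length bs"
    unfolding ordered_basis_def using dim_span_eq_card_independent[of "set bs"] by (auto simp: distinct_card)
  then show ?thesis
    using that[OF b] unfolding slopes_on_def eigenvalues_on_def char_poly_on_def bs_def by simp
qed

lemma change_of_basis:
  assumes "lin_indep xs" "span (set xs) = UNIV" "length xs = n" "coords xs (map T xs) M"
  obtains G H where "coords es xs G" "coords xs es H" "G \<in> carrier_mat n n" "H \<in> carrier_mat n n"
    "G * H = 1\<^sub>m n" "H * G = 1\<^sub>m n" "A * G = G * M" "char_poly A = char_poly M"
proof -
  obtain G H where G: "coords es xs G" and H: "coords xs es H"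
    using coords_exist[of xs es] coords_exist[of es xs] assms(2) span_es by auto
  have carr: "G \<in> carrier_mat n n" "H \<in> carrier_mat n n" "M \<in> carrier_mat n n"
    using G H assms len_es by (auto simp: coords_def)
  have GH: "G * H = 1\<^sub>m n"
    using coords_unique[OF basis_over_lin_indep[OF es] coords_trans[OF G H] coords_self] len_es by simp
  have HG: "H * G = 1\<^sub>m n"
    using coords_unique[OF assms(1) coords_trans[OF H G] coords_self] assms(3) by simp
  have AG: "A * G = G * M"
    by (rule coords_unique[OF basis_over_lin_indep[OF es] coords_trans[OF A coords_map[OF T G]] coords_trans[OF G assms(4)]])
  have "A = A * (G * H)" using GH A_carrier by simp
  also have "\<dots> = A * G * H" using carr A_carrier by (intro assoc_mult_mat[symmetric]) auto
  finally have "A = G * M * H" unfolding AG .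
  then have "similar_mat A M"
    unfolding similar_mat_def similar_mat_wit_def Let_def using carr GH HG A_carrier by (intro exI[of _ G] exI[of _ H]) auto
  then have "char_poly A = char_poly M" by (rule char_poly_similar)
  then show ?thesis using that G H carr GH HG AG by blast
qed

text \<open>
  The eigenvalues are listed in order of increasing valuation, so that the valuations of the list form
  the Newton point itself; the basis used in the definition of the characteristic polynomial is
  replaced by the basis of the lattice.
\<close>
lemma newton_point_eq:
  assumes "\<nu> = newton_point scale val T"
  obtains as where "char_poly (toK A) = (\<Prod>a\<leftarrow>as. [:- a, 1:])" "\<nu> = map val as" "length as = n"
    "slopes_on scale val T UNIV = image_mset val (proots (map_poly to_ac (char_poly A)))"
proof -
  obtain bs where bs: "ordered_basis scale UNIV bs" "length bs = dim UNIV"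
    and sl: "slopes_on scale val T UNIV = image_mset val (proots (map_poly to_ac (char_poly (matrix_wrt scale bs T))))"
    using slopes_on_eq[OF subspace_UNIV] by metis
  have len: "length bs = n" using bs n_def by simp
  have M: "coords bs (map T bs) (matrix_wrt scale bs T)" using coords_matrix_wrt[OF bs(1)] by simp
  have "span (set bs) = UNIV" using bs(1) by (simp add: ordered_basis_def)
  then have cp: "char_poly A = char_poly (matrix_wrt scale bs T)"
    using change_of_basis[OF ordered_basis_lin_indep[OF bs(1)] _ len M] by metis
  define E where "E = proots (map_poly to_ac (char_poly A))"
  obtain as0 where as0: "mset as0 = E" using ex_mset by blast
  define as where "as = sort_key val as0"
  have as: "mset as = E" using as0 by (simp add: as_def)
  have split: "char_poly (toK A) = (\<Prod>a\<leftarrow>as. [:- a, 1:])"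
    by (rule char_poly_to_ac_splits[OF A_carrier as[unfolded E_def]])
  have sl': "slopes_on scale val T UNIV = image_mset val E" using sl cp by (simp add: E_def)
  have "\<nu> = sorted_list_of_multiset (mset (map val as))"
    unfolding assms newton_point_def sl' by (simp add: as)
  also have "\<dots> = map val as" unfolding sorted_list_of_multiset_mset
    by (rule sorted_sort_id) (simp add: as_def)
  finally have "\<nu> = map val as" .
  moreover have "length as = n"
  proof -
    have AK: "toK A \<in> carrier_mat n n" using A_carrier by simp
    show ?thesis using degree_monic_char_poly[OF AK] unfolding split degree_linear_factors[of uminus as] by simp
  qed
  ultimately show ?thesis using that split sl' E_def by blast
qed

text \<open>
  Each partial sum of \<open>\<mu>\<close> is a bound for the minors, hence at most the partial sum of \<open>\<nu>\<close>.  Conversely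
  the valuation of the determinant, which is the sum of \<open>\<nu>\<close>, is a bound for the \<open>n\<close>-minors, hence at
  most the sum of \<open>\<mu>\<close>.
\<close>
lemma newton_le_hodge:
  assumes \<mu>: "\<mu> = hodge_point scale int_ring \<pi> T \<Lambda>" and \<nu>: "\<nu> = newton_point scale val T"
  shows "dominated \<nu> \<mu>"
proof -
  obtain as where as: "char_poly (toK A) = (\<Prod>a\<leftarrow>as. [:- a, 1:])" "\<nu> = map val as" "length as = n"
    using newton_point_eq[OF \<nu>] by metis
  have AK: "toK A \<in> carrier_mat n n" using A_carrier by simp
  have len: "length \<mu> = n" "length \<nu> = n" using hodge_point_minors(1)[OF \<mu>] as by auto
  have le: "sum_list (take i \<mu>) \<le> sum_list (take i \<nu>)" if "i \<le> n" for i
  proof -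
    have "K.minors_ge i (sum_list (take i \<mu>)) (toK A)" using hodge_point_minors(2)[OF \<mu> that] by simp
    then show ?thesis using K.minors_le_sum_slopes[OF AK as(1) _ that] as(2) by simp
  qed
  have "K.minors_ge n (sum_list \<nu>) (toK A)"
    using K.minors_ge_det[OF AK] K.v_det_eq_sum_slopes[OF AK as(1)] as(2) by simp
  then have "sum_list \<nu> \<le> sum_list \<mu>" using hodge_point_minors(2)[OF \<mu>, of n] len by simp
  then have "sum_list \<mu> = sum_list \<nu>" using le[of n] len by simp
  then show ?thesis using le len unfolding dominated_def by simp
qed

text \<open>
  Bases of \<open>U\<close> and \<open>W\<close> that triangularize \<open>T\<close> over the algebraic closure put the matrix of \<open>T\<close> into the
  form needed by \<open>invariant_projection_integral\<close>, so the projection onto \<open>U\<close> along \<open>W\<close> has an integral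
  matrix \<open>E\<close> in the basis of \<open>\<Lambda>\<close> and maps \<open>\<Lambda>\<close> into itself.  The slopes of \<open>U\<close> are the \<open>r\<close> smallest ones,
  so their sum is \<open>\<nu>\<^sub>1 + \<dots> + \<nu>\<^sub>r\<close>, which makes the hypothesis on \<open>\<mu>\<close> a bound on the \<open>r\<close>-minors.
\<close>
lemma hodge_newton_decomposition:
  assumes \<mu>: "\<mu> = hodge_point scale int_ring \<pi> T \<Lambda>" and \<nu>: "\<nu> = newton_point scale val T"
    and U: "subspace U" and W: "subspace W" and UW: "is_direct_sum UNIV U W"
    and TU: "T ` U \<subseteq> U" and TW: "T ` W \<subseteq> W"
    and slopes: "\<And>a b. a \<in># slopes_on scale val T U \<Longrightarrow> b \<in># slopes_on scale val T W \<Longrightarrow> a < b"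
    and r: "r = dim U" and sums: "sum_list (take r \<mu>) = sum_list (take r \<nu>)"
  shows "is_direct_sum \<Lambda> (\<Lambda> \<inter> U) (\<Lambda> \<inter> W)"
proof -
  have UWsum: "\<exists>u\<in>U. \<exists>w\<in>W. x = u + w" for x
    using UW unfolding is_direct_sum_def by blast
  have UW0: "U \<inter> W = {0}" using UW by (simp add: is_direct_sum_def)
  obtain bU where bU: "ordered_basis scale U bU" "length bU = r"
    and sU: "slopes_on scale val T U = image_mset val (proots (map_poly to_ac (char_poly (matrix_wrt scale bU T))))"
    using slopes_on_eq[OF U] r by metis
  obtain bW where bW: "ordered_basis scale W bW"
    and sW: "slopes_on scale val T W = image_mset val (proots (map_poly to_ac (char_poly (matrix_wrt scale bW T))))"
    using slopes_on_eq[OF W] by metis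
  have spU: "span (set bU) = U" and spW: "span (set bW) = W"
    using bU bW by (simp_all add: ordered_basis_def)
  have setU: "set bU \<subseteq> U" using span_superset[of "set bU"] unfolding spU .
  have setW: "set bW \<subseteq> W" using span_superset[of "set bW"] unfolding spW .
  define m where "m = length bW"
  define xs where "xs = bU @ bW"
  have xs_ind: "lin_indep xs"
    unfolding lin_indep_def
  proof (intro allI impI)
    fix c i assume c: "lc c xs = 0" and i: "i < length xs"
    define u where "u = lc c bU"
    define w where "w = lc (\<lambda>i. c (r + i)) bW"
    have uU: "u \<in> U" unfolding u_def by (rule lc_in_subspace[OF U setU])
    have wW: "w \<in> W" unfolding w_def by (rule lc_in_subspace[OF W setW])
    have uw: "u + w = 0" using c unfolding xs_def lc_append u_def w_def bU(2) .
    then have "u = - w" by (simp add: eq_neg_iff_add_eq_0)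
    then have "u \<in> W" using wW W by (simp add: subspace_neg)
    then have u0: "u = 0" using uU UW0 by blast
    then have w0: "w = 0" using uw by simp
    show "c i = 0"
    proof (cases "i < r")
      case True
      then show ?thesis using u0 ordered_basis_lin_indep[OF bU(1)] bU(2) unfolding u_def lin_indep_def by blast
    next
      case False
      then have "i - r < length bW" using i bU(2) by (simp add: xs_def)
      then have "c (r + (i - r)) = 0" using w0 ordered_basis_lin_indep[OF bW] unfolding w_def lin_indep_def by blast
      then show ?thesis using False by simp
    qed
  qed
  have xs_span: "span (set xs) = UNIV"
  proof -
    have "x \<in> span (set xs)" for x
    proof -
      obtain u w where "u \<in> U" "w \<in> W" "x = u + w" using UWsum by blast
      moreover have "U \<subseteq> span (set xs)" unfolding spU[symmetric] xs_def by (intro span_mono) simp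
      moreover have "W \<subseteq> span (set xs)" unfolding spW[symmetric] xs_def by (intro span_mono) simp
      ultimately show ?thesis by (metis span_add subsetD)
    qed
    then show ?thesis by blast
  qed
  have xs_len: "length xs = n"
  proof -
    have "card (set xs) = dim UNIV"
      using basis_card_eq_dim[of "set xs" UNIV] lin_indep_imp_independent[OF xs_ind] xs_span by simp
    then show ?thesis using distinct_card[OF lin_indep_imp_distinct[OF xs_ind]] n_def by simp
  qed
  then have n: "n = r + m" by (simp add: xs_def bU(2) m_def)
  define BU where "BU = matrix_wrt scale bU T"
  define BW where "BW = matrix_wrt scale bW T"
  have B: "BU \<in> carrier_mat r r" "BW \<in> carrier_mat m m"
    by (simp_all add: BU_def BW_def matrix_wrt_def bU(2) m_def)
  have BUc: "coords bU (map T bU) BU" unfolding BU_def by (rule coords_matrix_wrt[OF bU(1) TU])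
  have BWc: "coords bW (map T bW) BW" unfolding BW_def by (rule coords_matrix_wrt[OF bW TW])
  define M where "M = four_block_mat BU (0\<^sub>m r m) (0\<^sub>m m r) BW"
  have M: "M \<in> carrier_mat n n" using B n by (simp add: M_def)
  have Mc: "coords xs (map T xs) M"
    unfolding coords_def
  proof (intro conjI allI impI)
    fix j assume "j < length (map T xs)"
    then have j: "j < r + m" using xs_len n by simp
    have split: "lc (\<lambda>i. M $$ (i, j)) xs = lc (\<lambda>i. M $$ (i, j)) bU + lc (\<lambda>i. M $$ (r + i, j)) bW"
      unfolding xs_def lc_append bU(2) ..
    show "map T xs ! j = lc (\<lambda>i. M $$ (i, j)) xs"
    proof (cases "j < r")
      case True
      have "lc (\<lambda>i. M $$ (i, j)) bU = lc (\<lambda>i. BU $$ (i, j)) bU"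
        using B True bU(2) by (intro lc_cong) (auto simp: M_def)
      moreover have "lc (\<lambda>i. M $$ (r + i, j)) bW = 0"
        using B True by (intro lc_0) (auto simp: M_def m_def)
      ultimately show ?thesis using split BUc True bU(2) by (simp add: coords_def xs_def nth_append)
    next
      case False
      have "lc (\<lambda>i. M $$ (i, j)) bU = 0"
        using B False j bU(2) by (intro lc_0) (auto simp: M_def)
      moreover have "lc (\<lambda>i. M $$ (r + i, j)) bW = lc (\<lambda>i. BW $$ (i, j - r)) bW"
        using B False j by (intro lc_cong) (auto simp: M_def m_def)
      ultimately show ?thesis using split BWc False j bU(2) by (simp add: coords_def xs_def nth_append m_def)
    qed
  qed (use M xs_len in simp)
  obtain G H where G: "coords es xs G" and H: "coords xs es H"
    and GH: "G \<in> carrier_mat n n" "H \<in> carrier_mat n n" "G * H = 1\<^sub>m n" "H * G = 1\<^sub>m n"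
    and AG: "A * G = G * M"
    using change_of_basis[OF xs_ind xs_span xs_len Mc] by metis
  obtain asU where asU: "mset asU = proots (map_poly to_ac (char_poly BU))" using ex_mset by blast
  obtain asW where asW: "mset asW = proots (map_poly to_ac (char_poly BW))" using ex_mset by blast
  have BK: "toK BU \<in> carrier_mat r r" "toK BW \<in> carrier_mat m m" using B by auto
  obtain PU QU where PQU: "K.integral_inverses r PU QU"
    and RU: "upper_triangular (QU * toK BU * PU)" "diag_mat (QU * toK BU * PU) = asU"
    using K.integral_triangularization[OF BK(1) char_poly_to_ac_splits[OF B(1) asU]] .
  obtain PW QW where PQW: "K.integral_inverses m PW QW"
    and RW: "upper_triangular (QW * toK BW * PW)" "diag_mat (QW * toK BW * PW) = asW"
    using K.integral_triangularization[OF BK(2) char_poly_to_ac_splits[OF B(2) asW]] .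
  have cU: "PU \<in> carrier_mat r r" "QU \<in> carrier_mat r r" "PU * QU = 1\<^sub>m r" "QU * PU = 1\<^sub>m r"
    and cW: "PW \<in> carrier_mat m m" "QW \<in> carrier_mat m m" "PW * QW = 1\<^sub>m m" "QW * PW = 1\<^sub>m m"
    using PQU PQW by (auto simp: K.integral_inverses_def)
  define SU where "SU = QU * toK BU * PU"
  define SW where "SW = QW * toK BW * PW"
  have S: "SU \<in> carrier_mat r r" "SW \<in> carrier_mat m m" using cU cW BK by (auto simp: SU_def SW_def)
  have PS: "PU * SU = toK BU * PU" "PW * SW = toK BW * PW"
  proof -
    have "PU * SU = (PU * QU) * (toK BU * PU)" unfolding SU_def
      using cU(1,2) BK(1) by (simp add: assoc_mult_mat[of _ r r _ r _ r])
    then show "PU * SU = toK BU * PU" using cU BK(1) by simp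
    have "PW * SW = (PW * QW) * (toK BW * PW)" unfolding SW_def
      using cW(1,2) BK(2) by (simp add: assoc_mult_mat[of _ m m _ m _ m])
    then show "PW * SW = toK BW * PW" using cW BK(2) by simp
  qed
  define P where "P = four_block_mat PU (0\<^sub>m r m) (0\<^sub>m m r) PW"
  define Q where "Q = four_block_mat QU (0\<^sub>m r m) (0\<^sub>m m r) QW"
  define R where "R = four_block_mat SU (0\<^sub>m r m) (0\<^sub>m m r) SW"
  define J where "J = mat n n (\<lambda>(i, j). if i = j \<and> i < r then 1 else 0 :: 'f alg_closure)"
  have carr: "P \<in> carrier_mat n n" "Q \<in> carrier_mat n n" "R \<in> carrier_mat n n" "J \<in> carrier_mat n n"
    using cU cW S by (auto simp: P_def Q_def R_def J_def n)
  have J_block: "J = four_block_mat (1\<^sub>m r) (0\<^sub>m r m) (0\<^sub>m m r) (0\<^sub>m m m)"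
    unfolding J_def n by (rule eq_matI) auto
  note block = mult_four_block_mat[of _ r r _ m _ m _ _ r _ m]
  have PQ: "P * Q = 1\<^sub>m n" "Q * P = 1\<^sub>m n"
    unfolding P_def Q_def using cU cW n by (simp_all add: block)
  have toKM: "toK M = four_block_mat (toK BU) (0\<^sub>m r m) (0\<^sub>m m r) (toK BW)"
    unfolding M_def using B by (intro eq_matI) auto
  have MP: "toK M * P = P * R"
    unfolding toKM P_def R_def using cU cW BK S PS by (simp add: block)
  have JR: "J * R = R * J" unfolding J_block R_def using S by (simp add: block)
  have PJQ: "P * J * Q = J" unfolding J_block P_def Q_def using cU cW by (simp add: block)
  have R_ut: "upper_triangular R"
    unfolding R_def using S RU RW by (intro upper_triangular_four_block[of _ r _ m]) (auto simp: SU_def SW_def)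
  have R_diag: "diag_mat R = asU @ asW"
    unfolding R_def using S RU(2) RW(2) by (subst diag_four_block_mat[of _ r _ m]) (auto simp: SU_def SW_def)
  have len_as: "length asU = r" "length asW = m"
    using S unfolding RU(2)[symmetric] RW(2)[symmetric] SU_def[symmetric] SW_def[symmetric] by (simp_all add: diag_mat_def)
  have R_entry: "R $$ (k, k) = (asU @ asW) ! k" if "k < n" for k
    using that carr unfolding R_diag[symmetric] by (simp add: diag_mat_def)
  have R_slopes: "val (R $$ (i, i)) < val (R $$ (j, j))" if "i < r" "r \<le> j" "j < n" for i j
  proof (rule slopes)
    have "R $$ (i, i) \<in> set asU" using that R_entry[of i] len_as n by (simp add: nth_append)
    then show "val (R $$ (i, i)) \<in># slopes_on scale val T U" unfolding sU BU_def[symmetric] asU[symmetric] by simp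
    have "R $$ (j, j) \<in> set asW" using that R_entry[of j] len_as n by (simp add: nth_append)
    then show "val (R $$ (j, j)) \<in># slopes_on scale val T W" unfolding sW BW_def[symmetric] asW[symmetric] by simp
  qed
  note assoc = assoc_mult_mat[of _ n n _ n _ n]
  have AK: "toK A \<in> carrier_mat n n" using A_carrier by simp
  have GK: "toK G \<in> carrier_mat n n" "toK H \<in> carrier_mat n n" using GH by auto
  have GHK: "toK G * toK H = 1\<^sub>m n" "toK H * toK G = 1\<^sub>m n"
    using GH by (metis to_ac.mat_hom_mult to_ac.mat_hom_one)+
  define G' where "G' = toK G * P"
  define H' where "H' = Q * toK H"
  have G'c: "G' \<in> carrier_mat n n" "H' \<in> carrier_mat n n" using GK carr by (auto simp: G'_def H'_def)
  have G'H': "G' * H' = 1\<^sub>m n" "H' * G' = 1\<^sub>m n"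
    unfolding G'_def H'_def using K.mat_mult_cancel_middle GK GHK carr PQ by auto
  have AGK: "toK A * toK G = toK G * toK M"
    using AG A_carrier GH(1) M by (metis to_ac.mat_hom_mult)
  have AG': "toK A * G' = G' * R"
  proof -
    have MK: "toK M \<in> carrier_mat n n" using M by simp
    have "toK A * G' = (toK A * toK G) * P" unfolding G'_def using AK GK carr by (simp add: assoc)
    also have "\<dots> = toK G * (toK M * P)" unfolding AGK using GK MK carr by (simp add: assoc)
    also have "\<dots> = G' * R" unfolding MP G'_def using GK carr by (simp add: assoc)
    finally show ?thesis .
  qed
  have char_A: "char_poly (toK A) = (\<Prod>a\<leftarrow>asU @ asW. [:- a, 1:])"
  proof -
    have "toK A = toK A * (G' * H')" using G'H' AK by simp
    also have "\<dots> = toK A * G' * H'" using AK G'c by (simp add: assoc)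
    finally have "toK A = G' * R * H'" unfolding AG' .
    then have "similar_mat (toK A) R"
      unfolding similar_mat_def similar_mat_wit_def Let_def using carr G'c G'H' AK by (intro exI[of _ G'] exI[of _ H']) auto
    then have "char_poly (toK A) = char_poly R" by (rule char_poly_similar)
    then show ?thesis using char_poly_upper_triangular[OF carr(3) R_ut] R_diag by simp
  qed
  have slopes_UNIV: "slopes_on scale val T UNIV = slopes_on scale val T U + slopes_on scale val T W"
  proof -
    obtain as where as: "char_poly (toK A) = (\<Prod>a\<leftarrow>as. [:- a, 1:])" 
      and sl: "slopes_on scale val T UNIV = image_mset val (proots (map_poly to_ac (char_poly A)))"
      using newton_point_eq[OF \<nu>] by metis
    have "map_poly to_ac (char_poly A) = (\<Prod>a\<leftarrow>asU @ asW. [:- a, 1:])"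
      using char_A to_ac.char_poly_hom[OF A_carrier] by simp
    then have "proots (map_poly to_ac (char_poly A)) = mset asU + mset asW"
      by (metis proots_linear_factors mset_append)
    then show ?thesis unfolding sl sU sW BU_def[symmetric] BW_def[symmetric] asU[symmetric] asW[symmetric] by simp
  qed
  have "take r \<nu> = sorted_list_of_multiset (slopes_on scale val T U)"
  proof -
    have "length (sorted_list_of_multiset (slopes_on scale val T U)) = size (slopes_on scale val T U)"
      by (metis mset_sorted_list_of_multiset size_mset)
    also have "\<dots> = r" unfolding sU BU_def[symmetric] asU[symmetric] using len_as by simp
    finally show ?thesis
      unfolding \<nu> newton_point_def slopes_UNIV using sorted_list_of_multiset_union_less[OF slopes] by simp
  qed
  then have "sum_list (take r \<nu>) = sum_mset (slopes_on scale val T U)"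
    by (metis mset_sorted_list_of_multiset sum_mset_sum_list)
  also have "\<dots> = sum_list (map val asU)"
    unfolding sU BU_def[symmetric] asU[symmetric] by (metis mset_map sum_mset_sum_list)
  also have "\<dots> = (\<Sum>k<r. val (R $$ (k, k)))"
  proof -
    have "sum_list (map val asU) = (\<Sum>k<r. val (asU ! k))"
      using len_as by (simp add: sum_list_sum_nth atLeast0LessThan)
    also have "\<dots> = (\<Sum>k<r. val (R $$ (k, k)))"
      using R_entry n len_as by (intro sum.cong) (auto simp: nth_append)
    finally show ?thesis .
  qed
  finally have "sum_list (take r \<mu>) = (\<Sum>k<r. val (R $$ (k, k)))" using sums by simp
  moreover have rn: "r \<le> n" using n by simp
  ultimately have minors: "K.minors_ge r (\<Sum>k<r. val (R $$ (k, k))) (toK A)"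
    using hodge_point_minors(2)[OF \<mu> rn, of "sum_list (take r \<mu>)"] by simp
  have "K.integral_mat (G' * J * H')"
    unfolding J_def
    by (rule K.invariant_projection_integral[OF AK G'c G'H' carr(3) R_ut AG' JR[unfolded J_def] rn R_slopes minors])
  moreover
  define JF where "JF = mat n n (\<lambda>(i, j). if i = j \<and> i < r then 1 else 0 :: 'f)"
  have JF: "JF \<in> carrier_mat n n" by (simp add: JF_def)
  have toKJ: "toK JF = J" unfolding JF_def J_def by (rule eq_matI) auto
  define E where "E = G * (JF * H)"
  have E: "E \<in> carrier_mat n n" using GH JF by (simp add: E_def)
  have "G' * J * H' = toK G * (P * J * Q) * toK H"
    unfolding G'_def H'_def using GK carr by (simp add: assoc)
  also have "\<dots> = toK G * (toK JF * toK H)"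
    unfolding PJQ toKJ using GK carr by (simp add: assoc)
  also have "\<dots> = toK E"
    unfolding E_def using GH JF by (simp add: to_ac.mat_hom_mult[of _ n n _ n])
  ultimately have intE: "integral_mat E" by simp
  \<comment> \<open>the projections to \<open>U\<close> of the basis vectors of \<open>\<Lambda>\<close>\<close>
  define ys where "ys = map (\<lambda>j. lc (\<lambda>i. E $$ (i, j)) es) [0..<n]"
  have ys: "coords es ys E" "length ys = n" using E len_es by (auto simp: coords_def ys_def)
  have ysx: "coords xs ys (JF * H)"
    by (rule coords_cancel[OF G]) (use JF GH ys xs_len in \<open>auto simp: E_def\<close>)
  have JH: "(JF * H) $$ (i, j) = (if i < r then H $$ (i, j) else 0)" if "i < n" "j < n" for i j
  proof -
    have "(JF * H) $$ (i, j) = (\<Sum>k<n. if k = i then (if i < r then H $$ (i, j) else 0) else 0)"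
      unfolding mat_mult_entry[OF JF GH(2) that] using that by (intro sum.cong) (auto simp: JF_def)
    then show ?thesis using that by simp
  qed
  have ys_parts: "ys ! j \<in> U" "es ! j - ys ! j \<in> W" if "j < n" for j
  proof -
    have "ys ! j = lc (\<lambda>i. (JF * H) $$ (i, j)) xs" using ysx that ys(2) by (simp add: coords_def del: index_mult_mat(1))
    also have "\<dots> = lc (\<lambda>i. (JF * H) $$ (i, j)) bU + lc (\<lambda>i. (JF * H) $$ (r + i, j)) bW"
      unfolding xs_def lc_append bU(2) ..
    also have "lc (\<lambda>i. (JF * H) $$ (r + i, j)) bW = 0"
      using that n by (intro lc_0) (simp add: JH m_def del: index_mult_mat(1))
    also have "lc (\<lambda>i. (JF * H) $$ (i, j)) bU = lc (\<lambda>i. H $$ (i, j)) bU"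
      using that n bU(2) by (intro lc_cong) (simp add: JH del: index_mult_mat(1))
    finally have y: "ys ! j = lc (\<lambda>i. H $$ (i, j)) bU" by simp
    show "ys ! j \<in> U" unfolding y by (rule lc_in_subspace[OF U setU])
    have "es ! j = lc (\<lambda>i. H $$ (i, j)) xs" using H that len_es by (simp add: coords_def)
    also have "\<dots> = ys ! j + lc (\<lambda>i. H $$ (r + i, j)) bW" unfolding xs_def lc_append bU(2) y ..
    finally have "es ! j - ys ! j = lc (\<lambda>i. H $$ (r + i, j)) bW" by simp
    then show "es ! j - ys ! j \<in> W" using lc_in_subspace[OF W setW] by simp
  qed
  have ys_\<Lambda>: "span_over scale int_ring ys \<subseteq> \<Lambda>" unfolding \<Lambda>_eq by (rule span_over_mono[OF ys(1) intE])
  have \<Lambda>_diff: "x - y \<in> \<Lambda>" if "x \<in> \<Lambda>" "y \<in> \<Lambda>" for x y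
    using that span_over_diff unfolding \<Lambda>_eq by blast
  have \<Lambda>0: "0 \<in> \<Lambda>" unfolding \<Lambda>_eq using span_overI[of es "\<lambda>_. 0"] by (simp add: lc_0)
  have \<Lambda>_add: "x + y \<in> \<Lambda>" if "x \<in> \<Lambda>" "y \<in> \<Lambda>" for x y
    using \<Lambda>_diff[OF that(1) \<Lambda>_diff[OF \<Lambda>0 that(2)]] by simp
  have decomp: "\<exists>u w. x = u + w \<and> u \<in> \<Lambda> \<inter> U \<and> w \<in> \<Lambda> \<inter> W" if "x \<in> \<Lambda>" for x
  proof -
    obtain c where c: "x = lc c es" "\<And>i. i < length es \<Longrightarrow> 0 \<le> val (to_ac (c i))"
      using \<open>x \<in> \<Lambda>\<close> unfolding \<Lambda>_eq by (metis span_overE)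
    define u where "u = lc c ys"
    have uU: "u \<in> U" unfolding u_def using ys ys_parts(1) by (intro lc_in_subspace[OF U]) (auto simp: set_conv_nth)
    have u\<Lambda>: "u \<in> \<Lambda>" using ys_\<Lambda> span_overI[of ys c] c(2) len_es ys(2) unfolding u_def by auto
    have "x - u = (\<Sum>j<n. c j *s (es ! j - ys ! j))"
      unfolding c(1) u_def lin_comb_def len_es ys(2) by (simp add: scale_right_diff_distrib sum_subtractf)
    also have "\<dots> \<in> W" using ys_parts(2) by (intro subspace_sum[OF W] subspace_scale[OF W]) auto
    finally have "x - u \<in> \<Lambda> \<inter> W" using \<Lambda>_diff[OF \<open>x \<in> \<Lambda>\<close> u\<Lambda>] by simp
    then show ?thesis using uU u\<Lambda> by (intro exI[of _ u] exI[of _ "x - u"]) auto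
  qed
  show ?thesis
    unfolding is_direct_sum_def
  proof
    show "\<Lambda> = {b + c |b c. b \<in> \<Lambda> \<inter> U \<and> c \<in> \<Lambda> \<inter> W}"
    proof (intro equalityI subsetI)
      fix x assume "x \<in> \<Lambda>"
      then show "x \<in> {b + c |b c. b \<in> \<Lambda> \<inter> U \<and> c \<in> \<Lambda> \<inter> W}" using decomp by blast
    next
      fix x assume "x \<in> {b + c |b c. b \<in> \<Lambda> \<inter> U \<and> c \<in> \<Lambda> \<inter> W}"
      then show "x \<in> \<Lambda>" using \<Lambda>_add by blast
    qed
    show "\<Lambda> \<inter> U \<inter> (\<Lambda> \<inter> W) = {0}" using UW0 \<Lambda>0 by blast
  qed
qed

end

theorem theorem4p2:
  fixes \<oo> :: "'f::field set" and \<pi> :: 'f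
    and val :: "'f alg_closure \<Rightarrow> rat extended"
    and scale :: "'f \<Rightarrow> 'v::ab_group_add \<Rightarrow> 'v" and Basis :: "'v set"
    and T :: "'v \<Rightarrow> 'v" and \<Lambda> :: "'v set"
    and \<mu> \<nu> :: "rat extended list"
  assumes "is_complete_dvr \<oo> \<pi>"
    and "is_extended_valuation \<oo> \<pi> val"
    and "finite_dimensional_vector_space scale Basis"
    and "Vector_Spaces.linear scale scale T"
    and "is_lattice scale \<oo> \<Lambda>"
    and "\<mu> = hodge_point scale \<oo> \<pi> T \<Lambda>"
    and "\<nu> = newton_point scale val T"
  shows "dominated \<nu> \<mu> \<and>
    (\<forall>U W r.
       module.subspace scale U \<and> module.subspace scale W \<and>
       is_direct_sum UNIV U W \<and>
       T ` U \<subseteq> U \<and> T ` W \<subseteq> W \<and>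
       (\<forall>a \<in># slopes_on scale val T U.
          \<forall>b \<in># slopes_on scale val T W. a < b) \<and>
       r = vector_space.dim scale U \<and>
       sum_list (take r \<mu>) = sum_list (take r \<nu>) \<longrightarrow>
       is_direct_sum \<Lambda> (\<Lambda> \<inter> U) (\<Lambda> \<inter> W))"
proof -
  interpret fd: finite_dimensional_vector_space scale Basis by fact
  have val: "valuation val" and \<oo>: "\<oo> = {x. 0 \<le> val (to_ac x)}" and val_\<pi>: "val (to_ac \<pi>) = 1"
    using assms(2) by (auto simp: is_extended_valuation_def)
  interpret V: valued_space scale "\<lambda>x. val (to_ac x)"
    by unfold_locales (rule valuation_to_ac[OF val])
  have dvr: "is_dvr {x. 0 \<le> val (to_ac x)}" and unif: "is_uniformizer {x. 0 \<le> val (to_ac x)} \<pi>"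
    using assms(1) unfolding is_complete_dvr_def \<oo> by auto
  obtain es where es: "length es = fd.dim UNIV" "basis_over scale {x. 0 \<le> val (to_ac x)} es \<Lambda>" and sp: "fd.span \<Lambda> = UNIV"
    using assms(5) unfolding is_lattice_def \<oo> by auto
  have "\<Lambda> \<subseteq> fd.span (set es)"
  proof
    fix x assume "x \<in> \<Lambda>"
    then obtain c where "x = lin_comb scale c es" using es(2) unfolding basis_over_def span_over_def by blast
    then show "x \<in> fd.span (set es)"
      using V.lc_in_subspace[OF fd.subspace_span fd.span_superset] by simp
  qed
  then have span_es: "fd.span (set es) = UNIV" using sp fd.span_mono[of \<Lambda> "fd.span (set es)"] by (simp add: fd.span_span top.extremum_uniqueI)
  then obtain A where A: "V.coords es (map T es) A" using V.coords_exist[of "map T es" es] by auto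
  interpret hodge_newton_setting scale val Basis \<pi> T \<Lambda> es A "fd.dim UNIV"
    by (intro hodge_newton_setting.intro hodge_newton_setting_axioms.intro V.valued_space_axioms assms(3,4)
        val val_\<pi> dvr unif refl es span_es A)
  have \<mu>: "\<mu> = hodge_point scale {x. 0 \<le> val (to_ac x)} \<pi> T \<Lambda>" using assms(6) \<oo> by simp
  show ?thesis
    using newton_le_hodge[OF \<mu> assms(7)] hodge_newton_decomposition[OF \<mu> assms(7)] by blast
qed

end
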